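(* For every $n\in\mathbb{N}=\{0,1,2,\dots\}$, the polynomials $p^B_{n,k}(x)$ defined in the context satisfy the following. (a) The polynomial $p^B_{n,k}(x)$ has nonnegative coefficients for every $k\in\{0,1,\dots,n+1\}$; its degree is equal to $n+1$ if $k=n+1$, and to $n$ otherwise. (b) $p^B_{n,n+1-k}(x)=x^{n+1}p^B_{n,k}(1/x)$ for every $k\in\{0,1,\dots,n+1\}$. (c) $p^B_{n,0}(x)=B_n(x)$, $p^B_{n,n+1}(x)=xB_n(x)$ and $\sum_{k=0}^{n+1}p^B_{n,k}(x)=B_{n+1}(x)$, where $B_n(x)$ is the Eulerian polynomial of type $B_n$. (d) For $k\in\{0,1,\dots,n+1\}$, $$p^B_{n+1,k+1}(x)=\begin{cases}2\,p^B_{n+1,0}(x)+2(x-1)\,p^B_{n,0}(x), & \text{if } k=0,\\ p^B_{n+1,k}(x)+2(x-1)\,p^B_{n,k}(x), & \text{if } 1\le k\le n,\\ \tfrac12\,p^B_{n+1,n+1}(x)+(x-1)\,p^B_{n,n+1}(x), & \text{if } k=n+1.\end{cases}$$ (e) For $k\in\{0,1,\dots,n+2\}$, $$p^B_{n+1,k}(x)=\begin{cases}\displaystyle\sum_{i=0}^{n+1}p^B_{n,i}(x), & \text{if } k=0,\\ \displaystyle 2x\sum_{i=0}^{k-1}p^B_{n,i}(x)+2\sum_{i=k}^{n+1}p^B_{n,i}(x), & \text{if } 1\le k\le n+1,\\ \displaystyle x\sum_{i=0}^{n+1}p^B_{n,i}(x), & \text{if } k=n+2.\end{cases}$$ (f)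 For $k\in\{0,1,\dots,n+1\}$, as formal power series in $x$, $$\frac{p^B_{n,k}(x)}{(1-x)^{n+1}}=\begin{cases}\displaystyle\sum_{m\ge0}(2m+1)^nx^m, & \text{if } k=0,\\ \displaystyle\sum_{m\ge0}(4m)(2m-1)^{k-1}(2m+1)^{n-k}x^m, & \text{if } 1\le k\le n,\\ \displaystyle\sum_{m\ge1}(2m-1)^nx^m, & \text{if } k=n+1.\end{cases}$$
   Context: **Barycentric subdivision of the cube.** The barycentric subdivision of the $n$-dimensional cube is the abstract simplicial complex whose faces are the chains $\sigma_0\subset\sigma_1\subset\cdots\subset\sigma_k$ of nonempty faces of the cube (including the cube itself as a possible member of a chain, and including the empty chain). **Simplicial $h$-polynomials.** A relative simplicial complex $\Delta/\Gamma$ of dimension $n$ is a pair consisting of an $n$-dimensional abstract simplicial complex $\Delta$ and a subcomplex $\Gamma$; its faces are those of $\Delta$ not in $\Gamma$. Its $h$-polynomial is $h(\Delta/\Gamma,x)=\sum_{F\in\Delta\smallsetminus\Gamma}x^{|F|}(1-x)^{n+1-|F|}$, where $|F|$ is the number of vertices of $F$. When $\Gamma$ is empty (has no faces at all), this is $h(\Delta,x)$, in which the empty face of $\Delta$ is included. **The polynomials $p^B_{n,k}(x)$.** For $n\in\mathbb{N}$ and $k\in\{0,1,\dots,n+1\}$, $\mathcal{C}_{n,k}$ is the relative simplicial complex obtained from the barycentric subdivision of the $n$-dimensional cube by removing: no face, if $k=0$; all faces (including the empty face) which lie in one facet and $k-1$ pairs of antipodal facets of the cube (that is, all faces contained in at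 least one of these $2k-1$ distinct facets), if $k\in\{1,\dots,n\}$; all faces on the boundary of the cube (including the empty face), if $k=n+1$. Then $p^B_{n,k}(x)=h(\mathcal{C}_{n,k},x)$ for $k\in\{0,n+1\}$, and $p^B_{n,k}(x)=2h(\mathcal{C}_{n,k},x)$ for $k\in\{1,\dots,n\}$. **Type $B$ Eulerian polynomial.** $B_n(x)=\sum_wx^{\mathrm{des}_B(w)}$, where $w=(w_1,\dots,w_n)$ ranges over the signed permutations of $\{1,\dots,n\}$ (so $w_i\in\{\pm1,\dots,\pm n\}$ and $(|w_1|,\dots,|w_n|)$ is a permutation of $\{1,\dots,n\}$) and $\mathrm{des}_B(w)$ is the number of $i\in\{0,1,\dots,n-1\}$ with $w_i>w_{i+1}$, where $w_0=0$. In particular $B_0(x)=1$. *)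

theory Defs
  imports
    "Jordan_Normal_Form.Matrix"
    "HOL-Computational_Algebra.Polynomial_FPS"
    "HOL-Combinatorics.Multiset_Permutations"
begin

section \<open>The cube and its faces\<close>

text \<open>
  The dimension is a natural number that varies within the statements, so \<open>\<real>\<^sup>n\<close> is
  rendered as \<^term>\<open>carrier_vec n :: real vec set\<close>.  The cube is centred at the origin, which
  makes antipodal facets negatives of each other.
\<close>

definition cube :: "nat \<Rightarrow> real vec set" where
  "cube n = {x \<in> carrier_vec n. \<forall>i<n. \<bar>x $ i\<bar> \<le> 1}"

text \<open>
  A face is cut out by a valid linear inequality \<open>a \<bullet> x \<le> b\<close>.  Both the empty set
  (\<open>a = 0\<close>, \<open>b = 1\<close>) and the whole cube (\<open>a = 0\<close>, \<open>b = 0\<close>) are faces.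
\<close>

definition cube_face :: "nat \<Rightarrow> real vec set \<Rightarrow> bool" where
  "cube_face n F \<longleftrightarrow>
     (\<exists>a \<in> carrier_vec n. \<exists>b. (\<forall>x \<in> cube n. a \<bullet> x \<le> b) \<and> F = {x \<in> cube n. a \<bullet> x = b})"

definition cube_facet :: "nat \<Rightarrow> real vec set \<Rightarrow> bool" where
  "cube_facet n F \<longleftrightarrow> cube_face n F \<and> F \<noteq> cube n \<and>
     (\<forall>G. cube_face n G \<longrightarrow> F \<subseteq> G \<longrightarrow> G = F \<or> G = cube n)"

text \<open>
  The union of all proper faces.  It is empty for \<open>n = 0\<close>, as the only proper face of a point is
  the empty one.
\<close>

definition cube_boundary :: "nat \<Rightarrow> real vec set" where
  "cube_boundary n = \<Union> {F. cube_face n F \<and> F \<noteq> cube n}"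

section \<open>Barycentric subdivision and \<open>h\<close>-polynomials\<close>

text \<open>A simplicial complex is given by its set of faces, each face being its set of vertices.\<close>

definition bary_cube :: "nat \<Rightarrow> real vec set set set" where
  "bary_cube n = {C. finite C \<and> subset.chain {F. cube_face n F \<and> F \<noteq> {}} C}"

text \<open>
  A face \<open>C\<close> of the subdivision lies in a subset \<open>Y\<close> of the cube if every cube face in the chain
  \<open>C\<close> does; the empty chain thus lies in every \<open>Y\<close>.
\<close>

definition faces_in :: "nat \<Rightarrow> real vec set \<Rightarrow> real vec set set set" where
  "faces_in n Y = {C \<in> bary_cube n. \<Union>C \<subseteq> Y}"

text \<open>
  The \<open>h\<close>-polynomial of the relative complex \<open>\<Delta>/\<Gamma>\<close>; here \<^term>\<open>Max (card ` \<Delta>)\<close> is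
  \<open>dim \<Delta> + 1\<close>.
\<close>

definition h_poly :: "'a set set \<Rightarrow> 'a set set \<Rightarrow> real poly" where
  "h_poly \<Delta> \<Gamma> =
     (\<Sum>F \<in> \<Delta> - \<Gamma>. monom 1 (card F) * (1 - monom 1 1) ^ (Max (card ` \<Delta>) - card F))"

section \<open>The polynomials \<open>p\<^sup>B\<close>\<close>

text \<open>
  \<open>T\<close> consists of \<open>2k - 1\<close> distinct facets: one facet \<open>F\<close>, and the \<open>k - 1\<close> antipodal pairs
  \<open>{G, -G}\<close> with \<open>G \<in> P\<close>.
\<close>

definition facet_selection :: "nat \<Rightarrow> nat \<Rightarrow> real vec set set \<Rightarrow> bool" where
  "facet_selection n k T \<longleftrightarrow>
     (\<exists>F P. cube_facet n F \<and> (\<forall>G\<in>P. cube_facet n G) \<and> card P = k - 1 \<and>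
        T = {F} \<union> P \<union> (\<lambda>G. uminus ` G) ` P \<and> finite T \<and> card T = 2 * k - 1)"

text \<open>
  The parameter \<open>S\<close> records which facets are removed: \<open>S n k\<close> is the selection used for
  \<open>\<C>\<^bsub>n,k\<^esub>\<close> with \<open>1 \<le> k \<le> n\<close>, and is to satisfy \<^term>\<open>facet_selection n k (S n k)\<close>.
  The values are meant for \<open>k \<le> n + 1\<close> only.
\<close>

definition removed_faces ::
  "(nat \<Rightarrow> nat \<Rightarrow> real vec set set) \<Rightarrow> nat \<Rightarrow> nat \<Rightarrow> real vec set set set" where
  "removed_faces S n k =
     (if k = 0 then {}
      else if k \<le> n then (\<Union>F \<in> S n k. faces_in n F)
      else faces_in n (cube_boundary n))"

definition pB :: "(nat \<Rightarrow> nat \<Rightarrow> real vec set set) \<Rightarrow> nat \<Rightarrow> nat \<Rightarrow> real poly" where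
  "pB S n k =
     (if 1 \<le> k \<and> k \<le> n then 2 * h_poly (bary_cube n) (removed_faces S n k)
      else h_poly (bary_cube n) (removed_faces S n k))"

section \<open>Type \<open>B\<close> Eulerian polynomials\<close>

definition signed_perms :: "nat \<Rightarrow> int list set" where
  "signed_perms n = {w. map abs w \<in> permutations_of_set {1..int n}}"

text \<open>Prepending \<open>0\<close> realises the convention \<open>w\<^sub>0 = 0\<close>.\<close>

definition desB :: "int list \<Rightarrow> nat" where
  "desB w = card {i. i < length w \<and> (0 # w) ! i > (0 # w) ! (i + 1)}"

definition eulerian_B :: "nat \<Rightarrow> real poly" where
  "eulerian_B n = (\<Sum>w \<in> signed_perms n. monom 1 (desB w))"

section \<open>Existence of facet selections\<close>

definition std_facet :: "nat \<Rightarrow> nat \<Rightarrow> real \<Rightarrow> real vec set" where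
  "std_facet n i s = {x \<in> cube n. x $ i = s}"

lemma scalar_prod_smult_unit:
  fixes s :: real
  assumes "c \<in> carrier_vec n" "i < n"
  shows "c \<bullet> (s \<cdot>\<^sub>v unit_vec n i) = s * c $ i"
  using assms by (simp add: scalar_prod_smult_distrib[OF assms(1)])

lemma cube_facet_std:
  assumes i: "i < n" and s: "s = 1 \<or> s = -1"
  shows "cube_facet n (std_facet n i s)"
proof -
  have prod: "(s \<cdot>\<^sub>v unit_vec n i) \<bullet> x = s * x $ i" if "x \<in> cube n" for x
  proof -
    have x: "x \<in> carrier_vec n" using that by (simp add: cube_def)
    show ?thesis
      using i x smult_scalar_prod_distrib[OF unit_vec_carrier x, of s i] by simp
  qed
  have bnd: "\<bar>x $ i\<bar> \<le> 1" if "x \<in> cube n" for x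
    using that i by (simp add: cube_def)
  have le: "s * x $ i \<le> 1" if "x \<in> cube n" for x
    using bnd[OF that] s by auto
  have face: "cube_face n (std_facet n i s)"
    unfolding cube_face_def
  proof (intro bexI exI conjI ballI)
    show "(s \<cdot>\<^sub>v unit_vec n i) \<bullet> x \<le> 1" if "x \<in> cube n" for x
      using prod[OF that] le[OF that] by simp
    show "std_facet n i s = {x \<in> cube n. (s \<cdot>\<^sub>v unit_vec n i) \<bullet> x = 1}"
    proof -
      have "(x $ i = s) = (s * x $ i = 1)" for x :: "real vec" using s by auto
      thus ?thesis using prod by (auto simp: std_facet_def)
    qed
  qed simp
  have "0\<^sub>v n \<in> cube n" "0\<^sub>v n \<notin> std_facet n i s"
    using s i by (auto simp: cube_def std_facet_def)
  hence proper: "std_facet n i s \<noteq> cube n" by auto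
  have "G = std_facet n i s \<or> G = cube n"
    if G: "cube_face n G" and sub: "std_facet n i s \<subseteq> G" for G
  proof -
    from G obtain c d where c: "c \<in> carrier_vec n" and Gd: "G = {x \<in> cube n. c \<bullet> x = d}"
      unfolding cube_face_def by blast
    define e where "e = s \<cdot>\<^sub>v unit_vec n i"
    have e: "e \<in> std_facet n i s"
      using s i by (auto simp: e_def std_facet_def cube_def unit_vec_def)
    have ce: "c \<bullet> e = s * c $ i"
      unfolding e_def by (rule scalar_prod_smult_unit[OF c i])
    hence d: "d = s * c $ i" using e sub Gd by auto
    have zero: "c $ j = 0" if j: "j < n" "j \<noteq> i" for j
    proof -
      have mem: "e + unit_vec n j \<in> std_facet n i s"
        using s i j by (auto simp: e_def std_facet_def cube_def unit_vec_def)
      have "c \<bullet> (e + unit_vec n j) = c \<bullet> e + c \<bullet> unit_vec n j"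
        by (rule scalar_prod_add_distrib[OF c]) (auto simp: e_def)
      moreover have "c \<bullet> unit_vec n j = c $ j"
        using c j by simp
      ultimately show ?thesis using mem sub Gd d ce by auto
    qed
    have cx: "c \<bullet> x = c $ i * x $ i" if "x \<in> cube n" for x
    proof -
      have dim: "dim_vec x = n" using that by (simp add: cube_def)
      have "c \<bullet> x = (\<Sum>j\<in>{0..<n}. c $ j * x $ j)" by (simp add: scalar_prod_def dim)
      also have "\<dots> = (\<Sum>j\<in>{i}. c $ j * x $ j)"
        using i zero by (intro sum.mono_neutral_right) auto
      finally show ?thesis by simp
    qed
    show ?thesis
    proof (cases "c $ i = 0")
      case True
      thus ?thesis using Gd cx d by auto
    next
      case False
      thus ?thesis using Gd cx d by (auto simp: std_facet_def)
    qed
  qed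
  thus ?thesis using face proper by (simp add: cube_facet_def)
qed

lemma uminus_std_facet: "i < n \<Longrightarrow> uminus ` std_facet n i s = std_facet n i (- s)"
proof (intro equalityI subsetI)
  fix x assume i: "i < n" and x: "x \<in> std_facet n i (- s)"
  have "- x \<in> std_facet n i s" "x = - (- x)"
    using i x by (auto simp: std_facet_def cube_def)
  thus "x \<in> uminus ` std_facet n i s" by blast
qed (auto simp: std_facet_def cube_def)

lemma std_facet_inj:
  assumes "i < n" "s = 1 \<or> s = -1" "t = 1 \<or> t = -1" "std_facet n i s = std_facet n j t" "j < n"
  shows "i = j \<and> s = t"
proof -
  have "s \<cdot>\<^sub>v unit_vec n i \<in> std_facet n i s"
    using assms(1,2) by (auto simp: std_facet_def cube_def unit_vec_def)
  hence "(s \<cdot>\<^sub>v unit_vec n i) $ j = t"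
    unfolding assms(4) by (simp add: std_facet_def)
  thus ?thesis using assms by (auto simp: unit_vec_def split: if_splits)
qed

lemma facet_selection_exists:
  assumes "1 \<le> k" "k \<le> n"
  shows "\<exists>T. facet_selection n k T"
proof -
  let ?f = "\<lambda>(i, s). std_facet n i s"
  let ?A = "{(k - 1, 1)} \<union> {..<k - 1} \<times> {1, -1 :: real}"
  let ?P = "(\<lambda>i. std_facet n i 1) ` {..<k - 1}"
  have inj: "inj_on ?f ?A"
  proof (rule inj_onI, clarify)
    fix i s j t assume "(i, s) \<in> ?A" "(j, t) \<in> ?A" "std_facet n i s = std_facet n j t"
    thus "i = j \<and> s = t"
      using assms by (intro std_facet_inj) auto
  qed
  have "card ?A = 2 * k - 1"
    using assms by (subst card_Un_disjoint) (auto simp: card_cartesian_product)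
  hence cardT: "card (?f ` ?A) = 2 * k - 1"
    using card_image[OF inj] by simp
  have "inj_on (\<lambda>i. std_facet n i 1) {..<k - 1}"
    using assms by (intro inj_onI) (auto dest!: std_facet_inj[rotated 3])
  hence cardP: "card ?P = k - 1" by (simp add: card_image)
  have neg: "(\<lambda>G. uminus ` G) ` ?P = (\<lambda>i. std_facet n i (-1)) ` {..<k - 1}"
    unfolding image_image using assms by (intro image_cong refl) (simp add: uminus_std_facet)
  have T: "?f ` ?A = {std_facet n (k - 1) 1} \<union> ?P \<union> (\<lambda>G. uminus ` G) ` ?P"
    unfolding neg by (auto simp: image_iff)
  have "facet_selection n k (?f ` ?A)"
    unfolding facet_selection_def
  proof (intro exI conjI)
    show "cube_facet n (std_facet n (k - 1) 1)" using assms by (intro cube_facet_std) auto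
    show "\<forall>G\<in>?P. cube_facet n G" using assms by (auto intro!: cube_facet_std)
  qed (use cardP cardT T in auto)
  thus ?thesis ..
qed

end

theory Submission
  imports Defs
begin

text \<open>
  Everything follows from the generating function in part (f).  Dividing the \<open>h\<close>-polynomial by
  \<open>(1 - x)\<^bsup>n+1\<^esup>\<close> turns the contribution of a chain \<open>C\<close> of faces into \<open>(x / (1 - x))\<^bsup>|C|\<^esup>\<close>, whose
  coefficient of \<open>x\<^sup>m\<close> is the number of multichains of length \<open>m\<close> with support \<open>C\<close>
  (\<open>fps_of_poly_h_poly\<close>).  Nonempty faces of the cube are given by sign vectors, a zero marking a
  free coordinate (\<open>cube_face_iff_sign_face\<close>).  Along a multichain each coordinate is fixed at one
  sign for a while and free afterwards; recording for how long, and at which sign, identifies the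
  multichains of length \<open>m\<close> with the lattice points of the cube \<open>[-m, m]\<^sup>n\<close>
  (\<open>bij_betw_flag\<close>).  A multichain lies in a facet of the cube precisely if its lattice point lies
  in the corresponding dilated facet, so removing facets restricts the range of single
  coordinates, and the coefficients in (f) come out as products (\<open>fps_of_poly_pB\<close>).

  The Eulerian polynomial satisfies \<open>B\<^sub>n / (1 - x)\<^bsup>n+1\<^esup> = \<Sum> (2 m + 1)\<^sup>n x\<^sup>m\<close>
  (\<open>fps_of_poly_eulerian_B\<close>), because inserting \<open>\<plusminus>(n + 1)\<close> into a signed permutation acts on the
  series as \<open>F \<mapsto> F + 2 x F'\<close>.

  A polynomial is determined by its generating function, so (c) and (d) are identities between
  the coefficients in (f), the sum in (c) being a telescoping one.  Part (e) follows from (c)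
  for the two extreme indices and by summing (d) over \<open>k\<close> for the others, and it expresses the polynomials for \<open>n + 1\<close> through those for \<open>n\<close>, with nonnegative
  coefficients and in a form that is symmetric under \<open>k \<mapsto> n + 2 - k\<close>.  Induction on \<open>n\<close> then gives
  (a) and (b).
\<close>

section \<open>The Eulerian polynomial of type B by insertion of the largest letter\<close>

text \<open>
  Descents of a word preceded by a given letter.  Recursion on the word is what makes the induction
  for the insertion of a new letter possible; \<open>desB\<close> is the case of the initial letter \<open>0\<close>.
\<close>

fun descents_from :: "int \<Rightarrow> int list \<Rightarrow> nat" where
  "descents_from a [] = 0"
| "descents_from a (b # w) = (if a > b then 1 else 0) + descents_from b w"

lemma card_descents_eq_descents_from:
  "card {i. i < length w \<and> (a # w) ! i > (a # w) ! (i + 1)} = descents_from a w"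
proof (induction w arbitrary: a)
  case (Cons b w)
  have "{i. i < length (b # w) \<and> (a # b # w) ! i > (a # b # w) ! (i + 1)}
      = (if a > b then {0} else {}) \<union> Suc ` {i. i < length w \<and> (b # w) ! i > (b # w) ! (i + 1)}"
    (is "?L = ?A \<union> Suc ` ?B")
  proof (rule Set.set_eqI)
    fix i show "i \<in> ?L \<longleftrightarrow> i \<in> ?A \<union> Suc ` ?B" by (cases i) auto
  qed
  moreover have "card (?A \<union> Suc ` ?B) = card ?A + card (Suc ` ?B)"
    by (intro card_Un_disjoint) auto
  moreover have "card (Suc ` ?B) = card ?B" by (simp add: card_image)
  ultimately show ?case using Cons.IH[of b] by (simp del: nth_Cons_Suc)
qed simp

lemma desB_eq_descents_from: "desB w = descents_from 0 w"
  unfolding desB_def by (rule card_descents_eq_descents_from)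

lemma descents_from_le_length: "descents_from a w \<le> length w"
proof (induction w arbitrary: a)
  case (Cons b w) show ?case using Cons.IH[of b] by simp
qed simp

definition insert_at :: "nat \<Rightarrow> 'a \<Rightarrow> 'a list \<Rightarrow> 'a list" where
  "insert_at p y w = take p w @ y # drop p w"

lemma insert_at_0 [simp]: "insert_at 0 y w = y # w"
  and insert_at_Suc_Cons [simp]: "insert_at (Suc p) y (b # w) = b # insert_at p y w"
  by (simp_all add: insert_at_def)

text \<open>
  Inserting \<open>N\<close> or \<open>- N\<close> into a gap between two letters replaces that gap by one ascent and one
  descent, so it keeps the number \<open>d\<close> of descents if the gap was a descent and raises it by one if
  it was an ascent.  At the end of the word, \<open>N\<close> adds nothing and \<open>- N\<close> adds a descent.  With \<open>d\<close>
  descents and \<open>length w - d\<close> ascents this gives the two coefficients.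
\<close>

lemma sum_descents_insert_at:
  fixes N :: int and x :: "'a :: comm_ring_1"
  assumes "\<bar>a\<bar> < N" "\<forall>b\<in>set w. \<bar>b\<bar> < N"
  shows "(\<Sum>p\<le>length w. x ^ descents_from a (insert_at p N w) + x ^ descents_from a (insert_at p (- N) w))
       = (2 * of_nat (descents_from a w) + 1) * x ^ descents_from a w
         + (2 * of_nat (length w - descents_from a w) + 1) * x ^ (descents_from a w + 1)"
  using assms
proof (induction w arbitrary: a)
  case Nil
  hence "\<not> N < a" "- N < a" by auto
  thus ?case by simp
next
  case (Cons b w)
  have N: "N > b" "\<not> a > N" "a > - N" "\<not> - N > b" using Cons.prems by auto
  define d where "d = descents_from b w"
  define e :: nat where "e = (if a > b then 1 else 0)"
  have d: "d \<le> length w" unfolding d_def by (rule descents_from_le_length)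
  have "(\<Sum>p\<le>length (b # w). x ^ descents_from a (insert_at p N (b # w)) + x ^ descents_from a (insert_at p (- N) (b # w)))
      = 2 * x ^ (d + 1) + x ^ e * (\<Sum>p\<le>length w. x ^ descents_from b (insert_at p N w) + x ^ descents_from b (insert_at p (- N) w))"
    using N
    by (simp add: sum.atMost_Suc_shift sum_distrib_left power_add d_def e_def algebra_simps
          del: sum.atMost_Suc)
  also have "\<dots> = 2 * x ^ (d + 1) + x ^ e * ((2 * of_nat d + 1) * x ^ d
         + (2 * of_nat (length w - d) + 1) * x ^ (d + 1))"
    using Cons.IH[of b] Cons.prems by (simp add: d_def)
  also have "\<dots> = (2 * of_nat (e + d) + 1) * x ^ (e + d)
         + (2 * of_nat (length (b # w) - (e + d)) + 1) * x ^ (e + d + 1)"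
    using d by (simp add: e_def of_nat_diff algebra_simps Suc_diff_le)
  finally show ?case by (simp add: d_def e_def)
qed

lemma signed_perms_iff:
  "w \<in> signed_perms n \<longleftrightarrow> set (map abs w) = {1..int n} \<and> distinct (map abs w)"
  by (simp add: signed_perms_def permutations_of_set_def)

lemma length_signed_perm: "w \<in> signed_perms n \<Longrightarrow> length w = n"
  using distinct_card[of "map abs w"] by (simp add: signed_perms_iff)

lemma abs_less_signed_perm:
  assumes "w \<in> signed_perms n" "b \<in> set w" shows "\<bar>b\<bar> < int (Suc n)"
proof -
  have "\<bar>b\<bar> \<in> set (map abs w)" using assms(2) by simp
  thus ?thesis using assms(1) by (auto simp: signed_perms_iff)
qed

text \<open>
  Deleting the letter of largest absolute value, and remembering its position and its sign, is
  the inverse map.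
\<close>

lemma bij_betw_insert_at_signed_perms:
  "bij_betw (\<lambda>(w, p, s). insert_at p (s * int (Suc n)) w)
     (signed_perms n \<times> {..n} \<times> {1, -1}) (signed_perms (Suc n))"
  (is "bij_betw ?f ?A ?B")
proof -
  define N where "N = int (Suc n)"
  have step: "set (map abs (insert_at p (s * N) w)) = insert N (set (map abs w))"
      "distinct (map abs (insert_at p (s * N) w)) \<longleftrightarrow> distinct (map abs w) \<and> N \<notin> set (map abs w)"
    if "s \<in> {1, -1}" for p s w
  proof -
    have N: "\<bar>s * N\<bar> = N" using that by (auto simp: N_def)
    have *: "map abs (insert_at p (s * N) w) = insert_at p N (map abs w)"
      using N by (simp add: insert_at_def take_map drop_map)
    have "mset (insert_at p N v) = add_mset N (mset v)" for v
      unfolding insert_at_def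
      by (metis append_take_drop_id mset.simps(2) mset_append union_mset_add_mset_right)
    hence **: "mset (insert_at p N (map abs w)) = mset (N # map abs w)" by simp
    show "set (map abs (insert_at p (s * N) w)) = insert N (set (map abs w))"
      unfolding * using mset_eq_setD[OF **] by simp
    show "distinct (map abs (insert_at p (s * N) w)) \<longleftrightarrow> distinct (map abs w) \<and> N \<notin> set (map abs w)"
      unfolding * using mset_eq_imp_distinct_iff[OF **] by auto
  qed
  \<comment> \<open>The inverse: delete the letters \<open>\<plusminus>N\<close>, and record where the first one stood and which sign occurred.\<close>
  define g where "g u = (filter (\<lambda>y. \<bar>y\<bar> \<noteq> N) u, length (takeWhile (\<lambda>y. \<bar>y\<bar> \<noteq> N) u),
      if N \<in> set u then 1 else -1 :: int)" for u
  have inv: "g (?f z) = z" if z: "z \<in> ?A" for z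
  proof -
    obtain w p s where zz: "z = (w, p, s)" by (cases z) auto
    hence w: "w \<in> signed_perms n" and p: "p \<le> n" and s: "s \<in> {1, -1}" using z by auto
    have len: "length w = n" using w by (rule length_signed_perm)
    have ne: "\<forall>b\<in>set w. \<bar>b\<bar> \<noteq> N" using abs_less_signed_perm[OF w] by (fastforce simp: N_def)
    have neN: "N \<notin> set w" "- N \<notin> set w" using ne by (auto simp: N_def)
    have net: "\<forall>b\<in>set (take p w). \<bar>b\<bar> \<noteq> N" "\<forall>b\<in>set (drop p w). \<bar>b\<bar> \<noteq> N"
      using ne by (auto dest: in_set_takeD in_set_dropD)
    have N: "\<bar>s * N\<bar> = N" "N \<noteq> - N" using s by (auto simp: N_def)
    have "filter (\<lambda>y. \<bar>y\<bar> \<noteq> N) (insert_at p (s * N) w) = w"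
      using N net by (simp add: insert_at_def filter_True)
    moreover have "takeWhile (\<lambda>y. \<bar>y\<bar> \<noteq> N) (insert_at p (s * N) w) = take p w"
      unfolding insert_at_def using net N by (subst takeWhile_append2) auto
    moreover have "N \<in> set (insert_at p (s * N) w) \<longleftrightarrow> s = 1"
      using s N neN by (auto simp: insert_at_def dest: in_set_takeD in_set_dropD)
    ultimately have "g (insert_at p (s * N) w) = (w, p, s)"
      using s p len unfolding g_def by auto
    thus ?thesis by (simp add: zz N_def)
  qed
  have "?f ` ?A = ?B"
  proof (intro equalityI subsetI)
    fix u assume "u \<in> ?f ` ?A"
    then obtain w p s where w: "w \<in> signed_perms n" and s: "s \<in> {1, -1}"
      and u: "u = insert_at p (s * N) w" by (auto simp: N_def)
    show "u \<in> ?B"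
      using w unfolding u signed_perms_iff step[OF s] by (auto simp: N_def)
  next
    fix u assume u: "u \<in> ?B"
    hence "N \<in> abs ` set u" by (auto simp: signed_perms_iff N_def)
    then obtain y where "y \<in> set u" "N = \<bar>y\<bar>" by auto
    then obtain s where s: "s \<in> {1, -1 :: int}" "s * N \<in> set u"
      by (cases "y \<ge> 0") force+
    then obtain ys zs where uz: "u = ys @ (s * N) # zs" by (auto dest: split_list)
    define w where "w = ys @ zs"
    have uw: "u = insert_at (length ys) (s * N) w" by (simp add: uz insert_at_def w_def)
    have "set (map abs w) = {1..int (Suc n)} - {N} \<and> distinct (map abs w)"
      using u unfolding uw signed_perms_iff step[OF s(1)] by auto
    moreover have "{1..int (Suc n)} - {N} = {1..int n}" by (auto simp: N_def)
    ultimately have w: "w \<in> signed_perms n" by (simp add: signed_perms_iff)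
    have "length ys \<le> n" using length_signed_perm[OF w] by (simp add: w_def)
    thus "u \<in> ?f ` ?A"
      using w s uw by (intro image_eqI[of _ _ "(w, length ys, s)"]) (auto simp: N_def)
  qed
  moreover have "inj_on ?f ?A" using inv by (rule inj_on_inverseI)
  ultimately show ?thesis by (simp add: bij_betw_def)
qed

lemma pderiv_sum: "pderiv (sum f A) = (\<Sum>a\<in>A. pderiv (f a))"
  by (induction A rule: infinite_finite_induct) (simp_all add: pderiv_add)

text \<open>
  Summing \<open>sum_descents_insert_at\<close> over all signed permutations; the factors \<open>d\<close> in front of
  \<open>x\<^sup>d\<close> become a derivative.
\<close>

lemma eulerian_B_Suc:
  "eulerian_B (Suc n) = (1 + of_nat (2 * n + 1) * monom 1 1) * eulerian_B n
     + 2 * monom 1 1 * (1 - monom 1 1) * pderiv (eulerian_B n)"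
proof -
  define x :: "real poly" where "x = monom 1 1"
  have mon: "monom 1 d = x ^ d" for d by (simp add: x_def monom_power)
  let ?f = "\<lambda>(w, p, s). insert_at p (s * int (Suc n)) w"
  have "eulerian_B (Suc n) = (\<Sum>z\<in>signed_perms n \<times> {..n} \<times> {1, -1}. x ^ desB (?f z))"
    unfolding eulerian_B_def mon
    by (rule sum.reindex_bij_betw[OF bij_betw_insert_at_signed_perms, symmetric])
  also have "\<dots> = (\<Sum>w\<in>signed_perms n. \<Sum>p\<le>n. \<Sum>s\<in>{1, -1}. x ^ desB (insert_at p (s * int (Suc n)) w))"
    by (simp add: sum.cartesian_product' case_prod_unfold)
  also have "\<dots> = (\<Sum>w\<in>signed_perms n. (2 * of_nat (desB w) + 1) * x ^ desB w
         + (2 * of_nat (n - desB w) + 1) * x ^ (desB w + 1))"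
  proof (rule sum.cong)
    fix w assume w: "w \<in> signed_perms n"
    show "(\<Sum>p\<le>n. \<Sum>s\<in>{1, -1}. x ^ desB (insert_at p (s * int (Suc n)) w)) =
        (2 * of_nat (desB w) + 1) * x ^ desB w + (2 * of_nat (n - desB w) + 1) * x ^ (desB w + 1)"
      using sum_descents_insert_at[of 0 "int (Suc n)" w x] abs_less_signed_perm[OF w]
        length_signed_perm[OF w]
      by (simp add: desB_eq_descents_from)
  qed simp
  also have "\<dots> = (\<Sum>w\<in>signed_perms n. (1 + of_nat (2 * n + 1) * x) * x ^ desB w
       + 2 * x * (1 - x) * pderiv (x ^ desB w))"
  proof (rule sum.cong)
    fix w assume w: "w \<in> signed_perms n"
    have le: "desB w \<le> n"
      using descents_from_le_length[of 0 w] length_signed_perm[OF w] by (simp add: desB_eq_descents_from)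
    have px: "pderiv x = 1" by (simp add: x_def pderiv_monom)
    have xp: "x * pderiv (x ^ d) = of_nat d * x ^ d" for d
    proof (cases d)
      case (Suc e)
      thus ?thesis by (simp only: pderiv_power_Suc px) (simp add: of_nat_poly algebra_simps)
    qed simp
    have "2 * x * (1 - x) * pderiv (x ^ desB w) = 2 * (1 - x) * (x * pderiv (x ^ desB w))"
      by (simp only: mult_ac)
    thus "(2 * of_nat (desB w) + 1) * x ^ desB w + (2 * of_nat (n - desB w) + 1) * x ^ (desB w + 1)
        = (1 + of_nat (2 * n + 1) * x) * x ^ desB w + 2 * x * (1 - x) * pderiv (x ^ desB w)"
      using le unfolding xp by (simp add: of_nat_diff algebra_simps)
  qed simp
  also have "\<dots> = (1 + of_nat (2 * n + 1) * x) * eulerian_B n + 2 * x * (1 - x) * pderiv (eulerian_B n)"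
    unfolding eulerian_B_def mon by (simp add: sum.distrib sum_distrib_left pderiv_sum)
  finally show ?thesis unfolding x_def .
qed

lemma eulerian_B_0: "eulerian_B 0 = 1"
proof -
  have "signed_perms 0 = {[]}" by (auto simp: signed_perms_iff)
  thus ?thesis by (simp add: eulerian_B_def desB_def)
qed

text \<open>
  If \<open>F = B\<^sub>n / (1 - x)\<^bsup>n+1\<^esup>\<close>, the recurrence above says that
  \<open>B\<^bsub>n+1\<^esub> / (1 - x)\<^bsup>n+2\<^esup> = F + 2 x F'\<close>, and \<open>F \<mapsto> F + 2 x F'\<close> multiplies the coefficient of
  \<open>x\<^sup>m\<close> by \<open>2 m + 1\<close>.
\<close>

lemma fps_of_poly_eulerian_B:
  "fps_of_poly (eulerian_B n) = Abs_fps (\<lambda>m. (2 * real m + 1) ^ n) * (1 - fps_X) ^ (n + 1)"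
proof (induction n)
  case 0
  have "Abs_fps (\<lambda>_. 1 :: real) * (1 - fps_X) = 1"
    by (rule fps_ext) (simp add: right_diff_distrib)
  thus ?case by (simp add: eulerian_B_0)
next
  case (Suc n)
  define F where "F = Abs_fps (\<lambda>m. (2 * real m + 1) ^ n)"
  define y :: "real fps" where "y = 1 - fps_X"
  have dy: "fps_deriv y = -1" by (simp add: y_def)
  have X: "fps_X = 1 - y" by (simp add: y_def)
  have fp: "fps_of_poly (pderiv p) = fps_deriv (fps_of_poly p)" for p :: "real poly"
    by (rule fps_of_poly_pderiv)
  have of_nat: "fps_of_poly (of_nat k) = (of_nat k :: real fps)" for k
    by (induction k) (simp_all add: fps_of_poly_add)
  have IH: "fps_of_poly (eulerian_B n) = F * y ^ (n + 1)" using Suc by (simp add: F_def y_def)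
  have "fps_of_poly (eulerian_B (Suc n)) =
      (1 + of_nat (2 * n + 1) * fps_X) * (F * y ^ (n + 1)) + 2 * fps_X * y * fps_deriv (F * y ^ (n + 1))"
    unfolding eulerian_B_Suc IH[symmetric] fp[symmetric]
    by (simp add: fps_of_poly_add fps_of_poly_mult fps_of_poly_diff fps_of_poly_monom' of_nat y_def)
  also have "fps_deriv (F * y ^ (n + 1)) = fps_deriv F * y ^ (n + 1) - of_nat (n + 1) * F * y ^ n"
    by (simp add: fps_deriv_power' dy algebra_simps del: power_Suc)

  also have "(1 + of_nat (2 * n + 1) * fps_X) * (F * y ^ (n + 1))
       + 2 * fps_X * y * (fps_deriv F * y ^ (n + 1) - of_nat (n + 1) * F * y ^ n)
      = (F + 2 * fps_X * fps_deriv F) * y ^ (n + 2)"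
    unfolding X by (simp add: algebra_simps)
  also have "F + 2 * fps_X * fps_deriv F = Abs_fps (\<lambda>m. (2 * real m + 1) ^ Suc n)"
  proof (rule fps_ext)
    fix m
    have "fps_nth (2 * fps_X * fps_deriv F) m = 2 * fps_nth (fps_X * fps_deriv F) m"
      by (simp only: numeral_fps_const mult.assoc fps_mult_left_const_nth)
    thus "fps_nth (F + 2 * fps_X * fps_deriv F) m = fps_nth (Abs_fps (\<lambda>m. (2 * real m + 1) ^ Suc n)) m"
      unfolding fps_add_nth by (cases m) (simp_all add: F_def algebra_simps)
  qed
  finally show ?case by (simp add: y_def)
qed

section \<open>\<open>h\<close>-polynomials and multichains\<close>

text \<open>
  For a chain \<open>C\<close> these lists are the multichains of length \<open>m\<close> with support \<open>C\<close>.
\<close>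

definition sorted_chains :: "nat \<Rightarrow> 'a set set \<Rightarrow> 'a set list set" where
  "sorted_chains m C = {xs. sorted_wrt (\<subseteq>) xs \<and> length xs = m \<and> set xs = C}"

lemma finite_sorted_chains: "finite C \<Longrightarrow> finite (sorted_chains m C)"
  by (rule finite_subset[OF _ finite_lists_length_eq[of C m]]) (auto simp: sorted_chains_def)

text \<open>
  Such a list starts with the least element \<open>b\<close> of the chain; the rest may or may not contain \<open>b\<close>
  again.
\<close>

lemma sorted_chains_Suc:
  assumes b: "b \<in> C" "\<forall>F\<in>C. b \<subseteq> F"
  shows "sorted_chains (Suc m) C = (#) b ` (sorted_chains m C \<union> sorted_chains m (C - {b}))"
proof (intro equalityI subsetI)
  fix xs assume xs: "xs \<in> sorted_chains (Suc m) C"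
  then obtain y ys where ys: "xs = y # ys" by (cases xs) (auto simp: sorted_chains_def)
  have "y \<in> C" "\<forall>F\<in>C. y \<subseteq> F" using xs by (auto simp: sorted_chains_def ys)
  hence "y = b" using b by blast
  thus "xs \<in> (#) b ` (sorted_chains m C \<union> sorted_chains m (C - {b}))"
    using xs by (cases "b \<in> set ys") (auto simp: sorted_chains_def ys)
next
  fix xs assume "xs \<in> (#) b ` (sorted_chains m C \<union> sorted_chains m (C - {b}))"
  thus "xs \<in> sorted_chains (Suc m) C" using b by (auto simp: sorted_chains_def)
qed

text \<open>
  A multichain with support \<open>C\<close> is a choice of a positive multiplicity for every element of \<open>C\<close>, so
  its generating function is \<open>(x / (1 - x))\<^bsup>|C|\<^esup>\<close>.  The induction removes the least element.
\<close>

lemma sorted_chains_fps: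
  assumes "finite C" "\<forall>F\<in>C. \<forall>G\<in>C. F \<subseteq> G \<or> G \<subseteq> F"
  shows "Abs_fps (\<lambda>m. real (card (sorted_chains m C))) * (1 - fps_X) ^ card C = fps_X ^ card C"
  using assms
proof (induction "card C" arbitrary: C)
  case 0
  hence C: "C = {}" by simp
  have "sorted_chains m {} = (if m = 0 then {[]} else {} :: 'a set list set)" for m
    by (auto simp: sorted_chains_def)
  hence "Abs_fps (\<lambda>m. real (card (sorted_chains m ({} :: 'a set set)))) = 1"
    by (intro fps_ext) auto
  thus ?case by (simp add: C)
next
  case (Suc j)
  have "C \<noteq> {}" using Suc by auto
  then obtain b where b: "b \<in> C" and "\<And>F. F \<in> C \<Longrightarrow> F \<subseteq> b \<Longrightarrow> b = F"
    using finite_has_minimal[OF Suc.prems(1)] by auto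
  hence bot: "\<forall>F\<in>C. b \<subseteq> F" using Suc.prems(2) by blast
  define y :: "real fps" where "y = 1 - fps_X"
  define D where "D = C - {b}"
  let ?A = "\<lambda>C. Abs_fps (\<lambda>m. real (card (sorted_chains m C)))"
  have cD: "card D = j" using Suc b by (simp add: D_def)
  have zero: "sorted_chains 0 C = {}" using b by (auto simp: sorted_chains_def)
  have suc: "card (sorted_chains (Suc m) C) = card (sorted_chains m C) + card (sorted_chains m D)" for m
  proof -
    have "sorted_chains m C \<inter> sorted_chains m D = {}"
      using b by (auto simp: sorted_chains_def D_def)
    thus ?thesis
      unfolding sorted_chains_Suc[OF b bot] D_def[symmetric] using Suc.prems(1)
      by (simp add: card_image card_Un_disjoint finite_sorted_chains D_def)
  qed
  have "?A C = fps_X * (?A C + ?A D)"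
  proof (intro fps_ext)
    fix m show "fps_nth (?A C) m = fps_nth (fps_X * (?A C + ?A D)) m"
      by (cases m) (simp_all add: zero suc)
  qed
  hence eq: "?A C * y = fps_X * ?A D" by (simp add: y_def algebra_simps)
  have "?A C * y ^ card C = (?A C * y) * y ^ j"
    by (simp flip: Suc.hyps(2))
  also have "\<dots> = fps_X * (?A D * y ^ card D)" unfolding eq cD by (simp only: mult.assoc)
  also have "?A D * y ^ card D = fps_X ^ card D"
    unfolding y_def using Suc.prems cD by (intro Suc.hyps(1)) (auto simp: D_def)
  finally show ?case unfolding cD y_def by (simp flip: Suc.hyps(2))
qed

text \<open>
  The face \<open>C\<close> contributes \<open>(x / (1 - x))\<^bsup>|C|\<^esup>\<close> to \<open>h / (1 - x)\<^bsup>dim + 1\<^esup>\<close>, which counts the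
  multichains with support \<open>C\<close>.
\<close>

lemma fps_of_poly_h_poly:
  assumes fin: "finite \<Delta>" and chains: "\<And>C. C \<in> \<Delta> \<Longrightarrow> finite C \<and> (\<forall>F\<in>C. \<forall>G\<in>C. F \<subseteq> G \<or> G \<subseteq> F)"
  shows "fps_of_poly (h_poly \<Delta> \<Gamma>) =
    Abs_fps (\<lambda>m. real (card {xs. sorted_wrt (\<subseteq>) xs \<and> length xs = m \<and> set xs \<in> \<Delta> - \<Gamma>}))
      * (1 - fps_X) ^ Max (card ` \<Delta>)"
proof -
  define N where "N = Max (card ` \<Delta>)"
  define y :: "real fps" where "y = 1 - fps_X"
  let ?A = "\<lambda>C. Abs_fps (\<lambda>m. real (card (sorted_chains m C)))"
  have "fps_of_poly (h_poly \<Delta> \<Gamma>) = (\<Sum>C\<in>\<Delta> - \<Gamma>. fps_X ^ card C * y ^ (N - card C))"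
    by (simp add: h_poly_def N_def fps_of_poly_sum fps_of_poly_mult fps_of_poly_power
        fps_of_poly_monom' fps_of_poly_diff y_def)
  also have "\<dots> = (\<Sum>C\<in>\<Delta> - \<Gamma>. ?A C * y ^ N)"
  proof (rule sum.cong)
    fix C assume C: "C \<in> \<Delta> - \<Gamma>"
    have "card C \<le> N" unfolding N_def using C fin by (intro Max_ge) auto
    hence "y ^ N = y ^ card C * y ^ (N - card C)"
      by (simp flip: power_add)
    thus "fps_X ^ card C * y ^ (N - card C) = ?A C * y ^ N"
      using sorted_chains_fps[of C] chains[of C] C by (simp flip: mult.assoc y_def)
  qed simp
  also have "\<dots> = (\<Sum>C\<in>\<Delta> - \<Gamma>. ?A C) * y ^ N" by (simp add: sum_distrib_right)
  also have "(\<Sum>C\<in>\<Delta> - \<Gamma>. ?A C) =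
    Abs_fps (\<lambda>m. real (card {xs. sorted_wrt (\<subseteq>) xs \<and> length xs = m \<and> set xs \<in> \<Delta> - \<Gamma>}))"
  proof (rule fps_ext)
    fix m
    have "{xs. sorted_wrt (\<subseteq>) xs \<and> length xs = m \<and> set xs \<in> \<Delta> - \<Gamma>} = (\<Union>C\<in>\<Delta> - \<Gamma>. sorted_chains m C)"
      by (auto simp: sorted_chains_def)
    moreover have "card (\<Union>C\<in>\<Delta> - \<Gamma>. sorted_chains m C) = (\<Sum>C\<in>\<Delta> - \<Gamma>. card (sorted_chains m C))"
      using fin chains
      by (intro card_UN_disjoint) (auto simp: finite_sorted_chains, auto simp: sorted_chains_def)
    ultimately show "fps_nth (\<Sum>C\<in>\<Delta> - \<Gamma>. ?A C) m = fps_nth (Abs_fps (\<lambda>m. real (card {xs. sorted_wrt (\<subseteq>) xs \<and>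
        length xs = m \<and> set xs \<in> \<Delta> - \<Gamma>}))) m"
      by (simp add: fps_sum_nth)
  qed
  finally show ?thesis by (simp add: N_def y_def)
qed

section \<open>Faces of the cube as sign vectors\<close>

text \<open>
  Meant for sign vectors, with entries in \<open>{-1, 0, 1}\<close> below \<open>n\<close>; a zero leaves its coordinate
  free.
\<close>

definition sign_face :: "nat \<Rightarrow> (nat \<Rightarrow> int) \<Rightarrow> real vec set" where
  "sign_face n \<sigma> = {x \<in> cube n. \<forall>i<n. \<sigma> i \<noteq> 0 \<longrightarrow> x $ i = of_int (\<sigma> i)}"

text \<open>
  The sign vector, read as a point (the centre of its face), is the witness that the inclusion of
  faces forces the relation between sign vectors in the next lemma.
\<close>

lemma sign_vec_in_sign_face:
  assumes "\<forall>i<n. \<sigma> i \<in> {-1, 0, 1}"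
  shows "vec n (\<lambda>i. of_int (\<sigma> i)) \<in> sign_face n \<sigma>"
  using assms by (force simp: sign_face_def cube_def)

lemma sign_face_subset_iff:
  assumes "\<forall>i<n. \<sigma> i \<in> {-1, 0, 1}"
  shows "sign_face n \<sigma> \<subseteq> sign_face n \<tau> \<longleftrightarrow> (\<forall>i<n. \<tau> i \<noteq> 0 \<longrightarrow> \<sigma> i = \<tau> i)"
proof
  assume "sign_face n \<sigma> \<subseteq> sign_face n \<tau>"
  thus "\<forall>i<n. \<tau> i \<noteq> 0 \<longrightarrow> \<sigma> i = \<tau> i"
    using sign_vec_in_sign_face[OF assms] by (auto simp: sign_face_def)
qed (auto simp: sign_face_def)

lemma sign_face_eq_iff:
  assumes "\<forall>i<n. \<sigma> i \<in> {-1, 0, 1}" "\<forall>i<n. \<tau> i \<in> {-1, 0, 1}"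
  shows "sign_face n \<sigma> = sign_face n \<tau> \<longleftrightarrow> (\<forall>i<n. \<sigma> i = \<tau> i)"
  unfolding set_eq_subset sign_face_subset_iff[OF assms(1)] sign_face_subset_iff[OF assms(2)]
  by metis

lemma std_facet_eq_sign_face:
  assumes "i < n" "s \<noteq> 0"
  shows "std_facet n i (of_int s) = sign_face n (\<lambda>j. if j = i then s else 0)"
  using assms by (auto simp: std_facet_def sign_face_def)

lemma cube_eq_sign_face: "cube n = sign_face n (\<lambda>_. 0)"
  by (simp add: sign_face_def)

text \<open>
  The maximum of \<open>x \<mapsto> a \<bullet> x\<close> over the cube is the \<open>\<ell>\<^sub>1\<close>-norm of \<open>a\<close>, since the terms \<open>a\<^sub>i x\<^sub>i\<close> can be
  maximised independently; it is attained exactly where each of them is maximal.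
\<close>

lemma cube_support:
  assumes a: "a \<in> carrier_vec n" and x: "x \<in> cube n"
  shows "a \<bullet> x \<le> (\<Sum>i<n. \<bar>a $ i\<bar>)"
    and "a \<bullet> x = (\<Sum>i<n. \<bar>a $ i\<bar>) \<longleftrightarrow> (\<forall>i<n. a $ i \<noteq> 0 \<longrightarrow> x $ i = sgn (a $ i))"
proof -
  have dim: "dim_vec x = n" using x by (simp add: cube_def)
  have prod: "a \<bullet> x = (\<Sum>i<n. a $ i * x $ i)"
    by (simp add: scalar_prod_def dim lessThan_atLeast0)
  have le: "a $ i * x $ i \<le> \<bar>a $ i\<bar>" if "i < n" for i
  proof -
    have "\<bar>a $ i\<bar> * \<bar>x $ i\<bar> \<le> \<bar>a $ i\<bar> * 1"
      using that x by (intro mult_left_mono) (auto simp: cube_def)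
    thus ?thesis using abs_ge_self[of "a $ i * x $ i"] by (simp add: abs_mult)
  qed
  show "a \<bullet> x \<le> (\<Sum>i<n. \<bar>a $ i\<bar>)"
    unfolding prod using le by (intro sum_mono) simp
  have eq: "a $ i * x $ i = \<bar>a $ i\<bar> \<longleftrightarrow> (a $ i \<noteq> 0 \<longrightarrow> x $ i = sgn (a $ i))" for i
    unfolding abs_sgn mult_cancel_left by auto
  have "a \<bullet> x = (\<Sum>i<n. \<bar>a $ i\<bar>) \<longleftrightarrow> (\<forall>i<n. a $ i * x $ i = \<bar>a $ i\<bar>)"
    unfolding prod using sum_mono_inv[of "\<lambda>i. a $ i * x $ i" "{..<n}" "\<lambda>i. \<bar>a $ i\<bar>"] le
    by (auto intro: sum.cong)
  thus "a \<bullet> x = (\<Sum>i<n. \<bar>a $ i\<bar>) \<longleftrightarrow> (\<forall>i<n. a $ i \<noteq> 0 \<longrightarrow> x $ i = sgn (a $ i))"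
    unfolding eq .
qed

text \<open>
  A valid inequality \<open>a \<bullet> x \<le> b\<close> that is tight somewhere has \<open>b\<close> equal to the maximum, and then
  \<open>cube_support\<close> shows that the face depends only on the signs of the coefficients of \<open>a\<close>.
\<close>

lemma cube_face_iff_sign_face:
  "cube_face n F \<and> F \<noteq> {} \<longleftrightarrow> (\<exists>\<sigma>. (\<forall>i<n. \<sigma> i \<in> {-1, 0, 1}) \<and> F = sign_face n \<sigma>)"
proof
  assume "cube_face n F \<and> F \<noteq> {}"
  then obtain a b where a: "a \<in> carrier_vec n" and b: "\<forall>x \<in> cube n. a \<bullet> x \<le> b"
    and F: "F = {x \<in> cube n. a \<bullet> x = b}" and ne: "F \<noteq> {}"
    unfolding cube_face_def by blast
  define \<sigma> :: "nat \<Rightarrow> int" where "\<sigma> i = (if a $ i > 0 then 1 else if a $ i < 0 then -1 else 0)" for i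
  have sgn: "of_int (\<sigma> i) = sgn (a $ i)" for i by (simp add: \<sigma>_def sgn_if)
  have z: "\<sigma> i = 0 \<longleftrightarrow> a $ i = 0" for i by (simp add: \<sigma>_def)
  have \<sigma>: "\<forall>i<n. \<sigma> i \<in> {-1, 0, 1}" by (simp add: \<sigma>_def)
  let ?v = "vec n (\<lambda>i. real_of_int (\<sigma> i))"
  have v: "?v \<in> cube n" using sign_vec_in_sign_face[OF \<sigma>] by (simp add: sign_face_def)
  have "a \<bullet> ?v = (\<Sum>i<n. \<bar>a $ i\<bar>)" by (subst cube_support(2)[OF a v]) (simp add: sgn)
  hence "b = (\<Sum>i<n. \<bar>a $ i\<bar>)" using b v ne F cube_support(1)[OF a] by force
  hence "F = sign_face n \<sigma>"
    unfolding F sign_face_def using cube_support(2)[OF a] by (auto simp: sgn z)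
  thus "\<exists>\<sigma>. (\<forall>i<n. \<sigma> i \<in> {-1, 0, 1}) \<and> F = sign_face n \<sigma>" using \<sigma> by blast
next
  assume "\<exists>\<sigma>. (\<forall>i<n. \<sigma> i \<in> {-1, 0, 1}) \<and> F = sign_face n \<sigma>"
  then obtain \<sigma> where \<sigma>: "\<forall>i<n. \<sigma> i \<in> {-1, 0, 1}" and F: "F = sign_face n \<sigma>" by blast
  define a where "a = vec n (\<lambda>i. real_of_int (\<sigma> i))"
  have a: "a \<in> carrier_vec n" by (simp add: a_def)
  have sgn: "sgn (a $ i) = of_int (\<sigma> i)" "a $ i = 0 \<longleftrightarrow> \<sigma> i = 0" if "i < n" for i
    using \<sigma> that by (auto simp: a_def)
  have "F = {x \<in> cube n. a \<bullet> x = (\<Sum>i<n. \<bar>a $ i\<bar>)}"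
    unfolding F sign_face_def using cube_support(2)[OF a] by (auto simp: sgn)
  hence "cube_face n F" unfolding cube_face_def using cube_support(1)[OF a] a by blast
  moreover have "F \<noteq> {}" using sign_vec_in_sign_face[OF \<sigma>] by (auto simp: F)
  ultimately show "cube_face n F \<and> F \<noteq> {}" ..
qed

lemma sign_face_is_face:
  assumes "\<forall>i<n. \<sigma> i \<in> {-1, 0, 1}"
  shows "cube_face n (sign_face n \<sigma>) \<and> sign_face n \<sigma> \<noteq> {}"
  unfolding cube_face_iff_sign_face using assms by (intro exI[of _ \<sigma>]) simp

lemma cube_faceE:
  assumes "cube_face n F" "F \<noteq> {}"
  obtains \<sigma> where "\<forall>i<n. \<sigma> i \<in> {-1, 0, 1}" "F = sign_face n \<sigma>"
  using cube_face_iff_sign_face[THEN iffD1, OF conjI, OF assms] by (elim exE conjE)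

lemma sign_face_subset_std_facet_iff:
  assumes "\<forall>i<n. \<sigma> i \<in> {-1, 0, 1}" "i < n" "s \<noteq> 0"
  shows "sign_face n \<sigma> \<subseteq> std_facet n i (of_int s) \<longleftrightarrow> \<sigma> i = s"
  unfolding std_facet_eq_sign_face[OF assms(2,3)] sign_face_subset_iff[OF assms(1)]
  using assms by auto

lemma sign_face_eq_cube_iff:
  assumes "\<forall>i<n. \<sigma> i \<in> {-1, 0, 1}"
  shows "sign_face n \<sigma> = cube n \<longleftrightarrow> (\<forall>i<n. \<sigma> i = 0)"
  unfolding cube_eq_sign_face using assms by (subst sign_face_eq_iff) auto

text \<open>
  The origin lies in no proper face, so the only face not contained in the boundary is the cube
  itself.
\<close>

lemma sign_face_subset_boundary_iff:
  assumes \<sigma>: "\<forall>i<n. \<sigma> i \<in> {-1, 0, 1}"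
  shows "sign_face n \<sigma> \<subseteq> cube_boundary n \<longleftrightarrow> (\<exists>i<n. \<sigma> i \<noteq> 0)"
proof
  assume "\<exists>i<n. \<sigma> i \<noteq> 0"
  hence "sign_face n \<sigma> \<noteq> cube n" using sign_face_eq_cube_iff[OF \<sigma>] by blast
  moreover have "cube_face n (sign_face n \<sigma>)" using sign_face_is_face[OF \<sigma>] ..
  ultimately show "sign_face n \<sigma> \<subseteq> cube_boundary n" by (auto simp: cube_boundary_def)
next
  assume sub: "sign_face n \<sigma> \<subseteq> cube_boundary n"
  show "\<exists>i<n. \<sigma> i \<noteq> 0"
  proof (rule ccontr)
    assume "\<not> (\<exists>i<n. \<sigma> i \<noteq> 0)"
    hence "0\<^sub>v n \<in> sign_face n \<sigma>" by (simp add: sign_face_def cube_def)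
    then obtain F where F: "cube_face n F" "F \<noteq> cube n" "0\<^sub>v n \<in> F"
      using sub by (auto simp: cube_boundary_def)
    then obtain \<tau> where \<tau>: "\<forall>i<n. \<tau> i \<in> {-1, 0, 1}" "F = sign_face n \<tau>"
      by (elim cube_faceE) auto
    have "\<forall>i<n. \<tau> i = 0" using F(3) unfolding \<tau>(2) by (force simp: sign_face_def)
    thus False using sign_face_eq_cube_iff[OF \<tau>(1)] F(2) \<tau>(2) by blast
  qed
qed

lemma finite_faces: "finite {F. cube_face n F \<and> F \<noteq> {}}"
proof (rule finite_subset)
  show "{F. cube_face n F \<and> F \<noteq> {}} \<subseteq> sign_face n ` ({..<n} \<rightarrow>\<^sub>E {-1, 0, 1})"
  proof
    fix F assume "F \<in> {F. cube_face n F \<and> F \<noteq> {}}"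
    then obtain \<sigma> where \<sigma>: "\<forall>i<n. \<sigma> i \<in> {-1, 0, 1}" "F = sign_face n \<sigma>"
      by (auto elim: cube_faceE)
    hence "F = sign_face n (restrict \<sigma> {..<n})" by (auto simp: sign_face_def)
    thus "F \<in> sign_face n ` ({..<n} \<rightarrow>\<^sub>E {-1, 0, 1})" using \<sigma>(1) by (intro image_eqI) (auto split: if_splits)
  qed
qed (intro finite_imageI finite_PiE, auto)

lemma finite_bary_cube: "finite (bary_cube n)"
  by (rule finite_subset[OF _ finite_Pow_iff[THEN iffD2, OF finite_faces[of n]]])
     (auto simp: bary_cube_def subset_chain_def)

text \<open>
  The number of free coordinates is strictly monotone on faces and takes values in \<open>{0..n}\<close>, which
  bounds the length of a chain; freeing the coordinates one at a time, starting with a vertex,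
  attains the bound.
\<close>

lemma Max_card_bary_cube: "Max (card ` bary_cube n) = n + 1"
proof (rule Max_eqI)
  show "finite (card ` bary_cube n)" by (simp add: finite_bary_cube)
next
  fix k assume "k \<in> card ` bary_cube n"
  then obtain C where C: "C \<in> bary_cube n" and k: "k = card C" by blast
  \<comment> \<open>The free coordinates of a face, described without reference to its sign vector.\<close>
  define free where "free F = {i. i < n \<and> \<not> F \<subseteq> std_facet n i (of_int 1) \<and> \<not> F \<subseteq> std_facet n i (of_int (-1))}"
    for F
  have free: "free (sign_face n \<sigma>) = {i. i < n \<and> \<sigma> i = 0}" if "\<forall>i<n. \<sigma> i \<in> {-1, 0, 1}" for \<sigma>
    using that sign_face_subset_std_facet_iff[OF that, of _ 1] sign_face_subset_std_facet_iff[OF that, of _ "-1"]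
    unfolding free_def by fastforce
  have strict: "F = G" if FG: "F \<in> C" "G \<in> C" "F \<subseteq> G" "card (free F) = card (free G)" for F G
  proof -
    have "cube_face n F \<and> F \<noteq> {}" "cube_face n G \<and> G \<noteq> {}"
      using C FG by (auto simp: bary_cube_def subset_chain_def)
    then obtain \<sigma> \<tau> where \<sigma>: "\<forall>i<n. \<sigma> i \<in> {-1, 0, 1}" "F = sign_face n \<sigma>"
      and \<tau>: "\<forall>i<n. \<tau> i \<in> {-1, 0, 1}" "G = sign_face n \<tau>"
      by (elim conjE cube_faceE)
    have sub: "\<forall>i<n. \<tau> i \<noteq> 0 \<longrightarrow> \<sigma> i = \<tau> i"
      using FG(3) sign_face_subset_iff[OF \<sigma>(1)] \<sigma>(2) \<tau>(2) by blast
    have "free F \<subseteq> free G" using sub unfolding \<sigma>(2) \<tau>(2) free[OF \<sigma>(1)] free[OF \<tau>(1)] by auto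
    hence "free F = free G" using FG(4) by (intro card_subset_eq) (auto simp: free_def)
    hence "\<forall>i<n. \<sigma> i = \<tau> i" using sub unfolding \<sigma>(2) \<tau>(2) free[OF \<sigma>(1)] free[OF \<tau>(1)] by fastforce
    thus ?thesis unfolding \<sigma>(2) \<tau>(2) by (simp add: sign_face_def)
  qed
  have "inj_on (\<lambda>F. card (free F)) C"
  proof (rule inj_onI)
    fix F G assume FG: "F \<in> C" "G \<in> C" "card (free F) = card (free G)"
    moreover have "F \<subseteq> G \<or> G \<subseteq> F" using C FG by (auto simp: bary_cube_def subset_chain_def)
    ultimately show "F = G" using strict[of F G] strict[of G F] by auto
  qed
  moreover have "card (free F) \<le> n" for F
    using card_mono[of "{..<n}" "free F"] by (auto simp: free_def)
  ultimately have "card C \<le> card {..n}" by (intro card_inj_on_le[of "\<lambda>F. card (free F)"]) auto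
  thus "k \<le> n + 1" by (simp add: k)
next
  \<comment> \<open>A maximal chain: the first \<open>j\<close> coordinates are free, the others are fixed at \<open>1\<close>.\<close>
  define \<sigma> :: "nat \<Rightarrow> nat \<Rightarrow> int" where "\<sigma> j i = (if i < j then 0 else 1)" for i j
  have \<sigma>: "\<forall>i<n. \<sigma> j i \<in> {-1, 0, 1}" for j by (simp add: \<sigma>_def)
  define C where "C = (\<lambda>j. sign_face n (\<sigma> j)) ` {..n}"
  have sub: "sign_face n (\<sigma> j) \<subseteq> sign_face n (\<sigma> k)" if "j \<le> k" for j k
    using that by (subst sign_face_subset_iff[OF \<sigma>]) (auto simp: \<sigma>_def)
  have "sign_face n (\<sigma> j) \<subseteq> sign_face n (\<sigma> k) \<or> sign_face n (\<sigma> k) \<subseteq> sign_face n (\<sigma> j)" for j k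
    using sub[of j k] sub[of k j] by linarith
  moreover have "cube_face n (sign_face n (\<sigma> j)) \<and> sign_face n (\<sigma> j) \<noteq> {}" for j
    by (rule sign_face_is_face[OF \<sigma>])
  ultimately have C: "C \<in> bary_cube n" unfolding bary_cube_def subset_chain_def C_def by auto
  have "inj_on (\<lambda>j. sign_face n (\<sigma> j)) {..n}"
  proof (rule linorder_inj_onI)
    fix j k assume "j < k" "j \<in> {..n}" "k \<in> {..n}"
    thus "sign_face n (\<sigma> j) \<noteq> sign_face n (\<sigma> k)"
      unfolding sign_face_eq_iff[OF \<sigma> \<sigma>] by (auto simp: \<sigma>_def intro!: exI[of _ j])
  qed auto
  hence "card C = n + 1" by (simp add: C_def card_image)
  thus "n + 1 \<in> card ` bary_cube n" using C by (metis image_eqI)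
qed

section \<open>Lattice points as multichains of faces\<close>

text \<open>
  An integer \<open>a\<close> with \<open>\<bar>a\<bar> \<le> m\<close> is encoded by a sequence of \<open>m\<close> signs: \<open>\<bar>a\<bar>\<close> copies of the sign
  of \<open>a\<close>, followed by zeros.  These are exactly the sequences of signs that one coordinate can
  follow along a multichain of faces, because a coordinate that has become free stays free.
\<close>

definition layer :: "int \<Rightarrow> nat \<Rightarrow> int" where
  "layer a t = (if int t < \<bar>a\<bar> then sgn a else 0)"

text \<open>
  The multichain of faces given by the lattice point \<open>g\<close>, all coordinates being encoded by
  \<open>layer\<close> at once.
\<close>

definition flag :: "nat \<Rightarrow> nat \<Rightarrow> (nat \<Rightarrow> int) \<Rightarrow> real vec set list" where
  "flag n m g = map (\<lambda>t. sign_face n (\<lambda>i. layer (g i) t)) [0..<m]"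

lemma layer_sign: "layer a t \<in> {-1, 0, 1}"
  by (auto simp: layer_def sgn_if)

text \<open>
  This makes the encoding injective.
\<close>

lemma sum_layer: "\<bar>a\<bar> \<le> int m \<Longrightarrow> (\<Sum>t<m. layer a t) = a"
proof -
  have "(\<Sum>t<m. layer a t) = sgn a * min (int m) \<bar>a\<bar>"
    by (induction m) (auto simp: layer_def min_def algebra_simps)
  thus "\<bar>a\<bar> \<le> int m \<Longrightarrow> (\<Sum>t<m. layer a t) = a" by (simp add: sgn_mult_abs)
qed

text \<open>
  The second hypothesis says that once a sign is zero it stays zero, and before that it is
  constant.
\<close>

lemma layers_exist:
  assumes "\<forall>t<m. s t \<in> {-1, 0, 1 :: int}" "\<forall>t u. t < u \<longrightarrow> u < m \<longrightarrow> s u \<noteq> 0 \<longrightarrow> s t = s u"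
  shows "\<exists>a. \<bar>a\<bar> \<le> int m \<and> (\<forall>t<m. s t = layer a t)"
  using assms
proof (induction m)
  case (Suc m)
  show ?case
  proof (cases "s m = 0")
    case True
    obtain a where "\<bar>a\<bar> \<le> int m" "\<forall>t<m. s t = layer a t" using Suc by auto
    thus ?thesis using True by (intro exI[of _ a]) (auto simp: less_Suc_eq layer_def)
  next
    case False
    have "\<forall>t<Suc m. s t = s m" using Suc.prems(2) False by (auto simp: less_Suc_eq)
    moreover have s: "s m = 1 \<or> s m = -1" using Suc.prems(1) False by auto
    moreover have "layer (s m * int (Suc m)) t = s m" if "t < Suc m" for t
      using that s by (auto simp: layer_def)
    moreover have "\<bar>s m * int (Suc m)\<bar> \<le> int (Suc m)" using s by auto
    ultimately show ?thesis by metis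
  qed
qed auto

lemma abs_le_of_box: "g \<in> {..<n} \<rightarrow>\<^sub>E {- int m..int m} \<Longrightarrow> i < n \<Longrightarrow> \<bar>g i\<bar> \<le> int m"
  by (force simp: PiE_iff abs_le_iff)

text \<open>
  Inclusion of faces is a condition on each coordinate separately, so a multichain amounts to an
  independent choice of a sequence of signs, as in \<open>layers_exist\<close>, for every coordinate.
\<close>

lemma bij_betw_flag:
  "bij_betw (flag n m) ({..<n} \<rightarrow>\<^sub>E {- int m..int m})
     {xs. sorted_wrt (\<subseteq>) xs \<and> length xs = m \<and> (\<forall>F\<in>set xs. cube_face n F \<and> F \<noteq> {})}"
  (is "bij_betw _ ?A ?B")
  unfolding bij_betw_def
proof (intro conjI equalityI subsetI)
  show "inj_on (flag n m) ?A"
  proof (rule inj_onI)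
    fix g h assume gh: "g \<in> ?A" "h \<in> ?A" and eq: "flag n m g = flag n m h"
    have lay: "layer (g i) t = layer (h i) t" if "i < n" "t < m" for i t
    proof -
      have "flag n m g ! t = flag n m h ! t" using eq by simp
      hence "sign_face n (\<lambda>i. layer (g i) t) = sign_face n (\<lambda>i. layer (h i) t)"
        using that by (simp add: flag_def)
      thus ?thesis using that by (subst (asm) sign_face_eq_iff) (auto simp: layer_sign[simplified])
    qed
    show "g = h"
    proof (rule PiE_ext[OF gh])
      fix i assume i: "i \<in> {..<n}"
      hence "\<bar>g i\<bar> \<le> int m" "\<bar>h i\<bar> \<le> int m" using gh by (auto intro: abs_le_of_box)
      hence "g i = (\<Sum>t<m. layer (g i) t)" "h i = (\<Sum>t<m. layer (h i) t)" by (simp_all add: sum_layer)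
      thus "g i = h i" using lay i by simp
    qed
  qed
next
  fix xs assume "xs \<in> flag n m ` ?A"
  then obtain g where xs: "xs = flag n m g" by blast
  have "\<forall>F\<in>set xs. cube_face n F \<and> F \<noteq> {}"
  proof
    fix F assume "F \<in> set xs"
    then obtain t where F: "F = sign_face n (\<lambda>i. layer (g i) t)" by (auto simp: xs flag_def)
    show "cube_face n F \<and> F \<noteq> {}"
      unfolding F by (intro sign_face_is_face) (use layer_sign in auto)
  qed
  moreover have "sorted_wrt (\<subseteq>) xs"
    unfolding xs flag_def sorted_wrt_map
  proof (rule sorted_wrt_mono_rel[OF _ sorted_wrt_upt])
    fix t u :: nat assume "t < u"
    thus "sign_face n (\<lambda>i. layer (g i) t) \<subseteq> sign_face n (\<lambda>i. layer (g i) u)"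
      by (subst sign_face_subset_iff) (use layer_sign in \<open>auto simp: layer_def\<close>)
  qed
  ultimately show "xs \<in> ?B" by (simp add: xs flag_def)
next
  fix xs assume "xs \<in> ?B"
  hence sorted: "sorted_wrt (\<subseteq>) xs" and len: "length xs = m"
    and faces: "\<forall>F\<in>set xs. cube_face n F \<and> F \<noteq> {}" by auto
  have "\<forall>t<m. \<exists>\<sigma>. (\<forall>i<n. \<sigma> i \<in> {-1, 0, 1}) \<and> xs ! t = sign_face n \<sigma>"
    using faces len by (metis nth_mem cube_faceE)
  then obtain \<sigma> where \<sigma>: "\<And>t. t < m \<Longrightarrow> \<forall>i<n. \<sigma> t i \<in> {-1, 0, 1}"
    and xs: "\<And>t. t < m \<Longrightarrow> xs ! t = sign_face n (\<sigma> t)" by metis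
  have "\<exists>a. \<bar>a\<bar> \<le> int m \<and> (\<forall>t<m. \<sigma> t i = layer a t)" if i: "i < n" for i
  proof (rule layers_exist)
    show "\<forall>t u. t < u \<longrightarrow> u < m \<longrightarrow> \<sigma> u i \<noteq> 0 \<longrightarrow> \<sigma> t i = \<sigma> u i"
    proof (intro allI impI)
      fix t u assume tu: "t < u" "u < m" "\<sigma> u i \<noteq> 0"
      hence "sign_face n (\<sigma> t) \<subseteq> sign_face n (\<sigma> u)"
        using sorted_wrt_nth_less[OF sorted, of t u] xs[of t] xs[of u] len by simp
      thus "\<sigma> t i = \<sigma> u i" using tu i by (subst (asm) sign_face_subset_iff[OF \<sigma>]) auto
    qed
  qed (use \<sigma> i in blast)
  then obtain a where a: "\<And>i. i < n \<Longrightarrow> \<bar>a i\<bar> \<le> int m"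
    and lay: "\<And>i t. i < n \<Longrightarrow> t < m \<Longrightarrow> \<sigma> t i = layer (a i) t" by metis
  have "xs = flag n m (restrict a {..<n})"
  proof (rule nth_equalityI)
    fix t assume "t < length xs"
    thus "xs ! t = flag n m (restrict a {..<n}) ! t"
      using xs[of t] lay len by (simp add: flag_def sign_face_def)
  qed (simp add: flag_def len)
  moreover have "restrict a {..<n} \<in> ?A" using a by (auto simp: abs_le_iff minus_le_iff)
  ultimately show "xs \<in> flag n m ` ?A" by blast
qed

text \<open>
  The multichain lies in the facet if all \<open>m\<close> signs of the coordinate \<open>i\<close> are \<open>s\<close>, which takes the
  extreme value \<open>s m\<close>.  For \<open>m = 0\<close> both sides hold, in
  accordance with the empty chain lying in every facet.
\<close>

lemma flag_in_facet_iff: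
  assumes g: "g \<in> {..<n} \<rightarrow>\<^sub>E {- int m..int m}" and i: "i < n" and s: "s = 1 \<or> s = -1"
  shows "\<Union> (set (flag n m g)) \<subseteq> std_facet n i (of_int s) \<longleftrightarrow> g i = s * int m"
proof -
  have "\<Union> (set (flag n m g)) \<subseteq> std_facet n i (of_int s) \<longleftrightarrow> (\<forall>t<m. layer (g i) t = s)"
  proof -
    have "sign_face n (\<lambda>i. layer (g i) t) \<subseteq> std_facet n i (of_int s) \<longleftrightarrow> layer (g i) t = s" for t
      using i s layer_sign by (intro sign_face_subset_std_facet_iff) auto
    thus ?thesis by (auto simp: flag_def UN_subset_iff)
  qed
  also have "\<dots> \<longleftrightarrow> g i = s * int m"
  proof
    assume "\<forall>t<m. layer (g i) t = s"
    moreover have "\<bar>g i\<bar> \<le> int m" using g i by (rule abs_le_of_box)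
    ultimately show "g i = s * int m" using sum_layer[of "g i" m] by (simp add: mult.commute)
  next
    assume "g i = s * int m"
    thus "\<forall>t<m. layer (g i) t = s" using s by (auto simp: layer_def abs_mult sgn_mult)
  qed
  finally show ?thesis .
qed

text \<open>
  Only the last face of the multichain matters.  The case \<open>m = 0\<close> is listed separately because of
  \<open>n = 0\<close>, where the origin is not on the boundary but the empty chain is.
\<close>

lemma flag_in_boundary_iff:
  assumes g: "g \<in> {..<n} \<rightarrow>\<^sub>E {- int m..int m}"
  shows "\<Union> (set (flag n m g)) \<subseteq> cube_boundary n \<longleftrightarrow> m = 0 \<or> (\<exists>i<n. \<bar>g i\<bar> = int m)"
proof -
  have *: "sign_face n (\<lambda>i. layer (g i) t) \<subseteq> cube_boundary n \<longleftrightarrow> (\<exists>i<n. int t < \<bar>g i\<bar>)" for t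
    by (subst sign_face_subset_boundary_iff) (use layer_sign in \<open>auto simp: layer_def sgn_0_0\<close>)
  have "\<Union> (set (flag n m g)) \<subseteq> cube_boundary n \<longleftrightarrow> (\<forall>t<m. \<exists>i<n. int t < \<bar>g i\<bar>)"
    by (auto simp: flag_def UN_subset_iff *)
  also have "\<dots> \<longleftrightarrow> m = 0 \<or> (\<exists>i<n. \<bar>g i\<bar> = int m)"
  proof (cases m)
    case (Suc l)
    have le: "\<bar>g i\<bar> \<le> int m" if "i < n" for i using g that by (rule abs_le_of_box)
    have "int l < \<bar>g i\<bar> \<longleftrightarrow> \<bar>g i\<bar> = int m" if "i < n" for i using le[OF that] Suc by auto
    thus ?thesis using Suc by (metis lessI nat.distinct(1) of_nat_less_iff)
  qed simp
  finally show ?thesis .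
qed

lemma comparable_if_sorted:
  "sorted_wrt (\<subseteq>) xs \<Longrightarrow> F \<in> set xs \<Longrightarrow> G \<in> set xs \<Longrightarrow> F \<subseteq> G \<or> G \<subseteq> F"
  by (induction xs) auto

lemma fps_of_poly_h_poly_bary_cube:
  "fps_of_poly (h_poly (bary_cube n) \<Gamma>) =
     Abs_fps (\<lambda>m. real (card {g \<in> {..<n} \<rightarrow>\<^sub>E {- int m..int m}. set (flag n m g) \<notin> \<Gamma>}))
       * (1 - fps_X) ^ (n + 1)"
proof -
  have "card {xs. sorted_wrt (\<subseteq>) xs \<and> length xs = m \<and> set xs \<in> bary_cube n - \<Gamma>}
      = card {g \<in> {..<n} \<rightarrow>\<^sub>E {- int m..int m}. set (flag n m g) \<notin> \<Gamma>}" for m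
  proof -
    let ?A = "{..<n} \<rightarrow>\<^sub>E {- int m..int m}"
    let ?B = "{xs. sorted_wrt (\<subseteq>) xs \<and> length xs = m \<and> (\<forall>F\<in>set xs. cube_face n F \<and> F \<noteq> {})}"
    have B: "?B = flag n m ` ?A" by (rule bij_betw_imp_surj_on[OF bij_betw_flag, symmetric])
    have "{xs. sorted_wrt (\<subseteq>) xs \<and> length xs = m \<and> set xs \<in> bary_cube n - \<Gamma>} = {xs \<in> ?B. set xs \<notin> \<Gamma>}"
      by (auto simp: bary_cube_def subset_chain_def dest: comparable_if_sorted)
    also have "\<dots> = flag n m ` {g \<in> ?A. set (flag n m g) \<notin> \<Gamma>}" unfolding B by blast
    also have "card \<dots> = card {g \<in> ?A. set (flag n m g) \<notin> \<Gamma>}"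
      using bij_betw_imp_inj_on[OF bij_betw_flag] by (intro card_image) (auto intro: inj_on_subset)
    finally show ?thesis .
  qed
  moreover have "fps_of_poly (h_poly (bary_cube n) \<Gamma>) =
    Abs_fps (\<lambda>m. real (card {xs. sorted_wrt (\<subseteq>) xs \<and> length xs = m \<and> set xs \<in> bary_cube n - \<Gamma>}))
       * (1 - fps_X) ^ Max (card ` bary_cube n)"
    by (rule fps_of_poly_h_poly) (auto simp: finite_bary_cube, auto simp: bary_cube_def subset_chain_def)
  ultimately show ?thesis unfolding Max_card_bary_cube by simp
qed

lemma set_flag_in_faces_in_iff:
  assumes "g \<in> {..<n} \<rightarrow>\<^sub>E {- int m..int m}"
  shows "set (flag n m g) \<in> faces_in n Y \<longleftrightarrow> \<Union> (set (flag n m g)) \<subseteq> Y"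
proof -
  have "flag n m g \<in> {xs. sorted_wrt (\<subseteq>) xs \<and> length xs = m \<and> (\<forall>F\<in>set xs. cube_face n F \<and> F \<noteq> {})}"
    using bij_betwE[OF bij_betw_flag] assms by (rule bspec)
  hence "set (flag n m g) \<in> bary_cube n"
    by (auto simp: bary_cube_def subset_chain_def dest: comparable_if_sorted)
  thus ?thesis by (simp add: faces_in_def)
qed

section \<open>Facet selections in coordinates\<close>

text \<open>
  In dimension \<open>0\<close> the empty set is a facet in the sense of \<open>cube_facet\<close>; in positive dimension it
  is not maximal.
\<close>

lemma cube_facet_is_std:
  assumes "cube_facet n F" "0 < n"
  obtains i s where "i < n" "s = 1 \<or> s = -1" "F = std_facet n i s"
proof -
  have F: "cube_face n F" "F \<noteq> cube n" using assms by (auto simp: cube_facet_def)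
  have max: "G = F \<or> G = cube n" if "cube_face n G" "F \<subseteq> G" for G
    using assms(1) that by (auto simp: cube_facet_def)
  have "F \<noteq> {}"
  proof
    assume "F = {}"
    moreover have "cube_facet n (std_facet n 0 1)" using assms by (intro cube_facet_std) auto
    moreover have "vec n (\<lambda>_. 1) \<in> std_facet n 0 1" using assms by (simp add: std_facet_def cube_def)
    ultimately show False using max[of "std_facet n 0 1"] by (auto simp: cube_facet_def)
  qed
  then obtain \<sigma> where \<sigma>: "\<forall>i<n. \<sigma> i \<in> {-1, 0, 1}" "F = sign_face n \<sigma>"
    using F(1) by (elim cube_faceE)
  then obtain i where i: "i < n" "\<sigma> i \<noteq> 0" using F(2) sign_face_eq_cube_iff[OF \<sigma>(1)] by blast
  hence s: "real_of_int (\<sigma> i) = 1 \<or> real_of_int (\<sigma> i) = -1" using \<sigma>(1) by auto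
  hence "cube_facet n (std_facet n i (of_int (\<sigma> i)))" using i by (intro cube_facet_std)
  moreover have "F \<subseteq> std_facet n i (of_int (\<sigma> i))"
    unfolding \<sigma>(2) using sign_face_subset_std_facet_iff[OF \<sigma>(1) i] by simp
  ultimately have "F = std_facet n i (of_int (\<sigma> i))"
    using max[of "std_facet n i (of_int (\<sigma> i))"] by (auto simp: cube_facet_def)
  thus ?thesis using that i s by blast
qed

text \<open>
  The cardinality \<open>2 k - 1\<close> of the selection is the largest possible, so no two of the facets
  named in it coincide; hence the pairs occupy \<open>k - 1\<close> coordinates and the single facet
  another one.
\<close>

lemma facet_selectionE:
  assumes T: "facet_selection n k T" and n: "0 < n"
  obtains i\<^sub>0 s\<^sub>0 J where "i\<^sub>0 < n" "s\<^sub>0 = 1 \<or> s\<^sub>0 = -1" "J \<subseteq> {..<n} - {i\<^sub>0}" "card J = k - 1"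
    "T = insert (std_facet n i\<^sub>0 s\<^sub>0) ((\<lambda>(i, s). std_facet n i s) ` (J \<times> {1, -1}))"
proof -
  obtain F P where F: "cube_facet n F" and P: "\<forall>G\<in>P. cube_facet n G" "card P = k - 1"
    and TP: "T = {F} \<union> P \<union> (\<lambda>G. uminus ` G) ` P" and fin: "finite T" and card: "card T = 2 * k - 1"
    using T unfolding facet_selection_def by blast
  obtain i\<^sub>0 s\<^sub>0 where i0: "i\<^sub>0 < n" "s\<^sub>0 = 1 \<or> s\<^sub>0 = -1" "F = std_facet n i\<^sub>0 s\<^sub>0"
    using cube_facet_is_std[OF F n] by blast
  let ?std = "\<lambda>(i, s). std_facet n i s"
  define J where "J = {i. i < n \<and> (\<exists>s. (s = 1 \<or> s = -1) \<and> std_facet n i s \<in> P)}"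
  have pairs: "P \<union> (\<lambda>G. uminus ` G) ` P = ?std ` (J \<times> {1, -1})"
  proof (intro equalityI subsetI)
    fix G assume "G \<in> P \<union> (\<lambda>G. uminus ` G) ` P"
    then obtain H where H: "H \<in> P" "G = H \<or> G = uminus ` H" by blast
    obtain i s where st: "i < n" "s = 1 \<or> s = -1" "H = std_facet n i s"
      using cube_facet_is_std[of n H] H P(1) n by metis
    hence "i \<in> J" using H by (auto simp: J_def)
    moreover have "G = std_facet n i s \<or> G = std_facet n i (- s)"
      using H(2) st by (auto simp: uminus_std_facet)
    ultimately show "G \<in> ?std ` (J \<times> {1, -1})" using st(2) by force
  next
    fix G assume "G \<in> ?std ` (J \<times> {1, -1})"
    then obtain i s where st: "i \<in> J" "s = 1 \<or> s = -1" "G = std_facet n i s" by auto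
    then obtain s' where s': "i < n" "s' = 1 \<or> s' = -1" "std_facet n i s' \<in> P" by (auto simp: J_def)
    have "s = s' \<or> s = - s'" using st s' by auto
    thus "G \<in> P \<union> (\<lambda>G. uminus ` G) ` P"
      using s'(1,3) st(3) by (auto simp: uminus_std_facet[symmetric])
  qed
  have "inj_on ?std (J \<times> {1, -1})"
    by (rule inj_onI) (auto simp: J_def dest!: std_facet_inj[rotated 3])
  hence cJ: "card (?std ` (J \<times> {1, -1})) = 2 * card J"
    by (simp add: card_image card_cartesian_product)
  have finJ: "finite J" by (simp add: J_def)
  have finP: "finite P" using fin TP by simp
  have T': "T = insert F (?std ` (J \<times> {1, -1}))" unfolding TP pairs[symmetric] by simp
  have "2 * card J \<le> card P + card ((\<lambda>G. uminus ` G) ` P)"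
    unfolding cJ[symmetric] pairs[symmetric] by (rule card_Un_le)
  also have "\<dots> \<le> 2 * (k - 1)" using card_image_le[OF finP, of "\<lambda>G. uminus ` G"] P(2) by simp
  finally have le: "2 * card J \<le> 2 * (k - 1)" .
  have cT: "card T = (if F \<in> ?std ` (J \<times> {1, -1}) then 2 * card J else Suc (2 * card J))"
    unfolding T' using finJ cJ by (simp add: card_insert_if)
  have "card T > 0" using fin TP by (auto simp: card_gt_0_iff)
  hence "k > 0" using card by simp
  hence notin: "F \<notin> ?std ` (J \<times> {1, -1})" and cardJ: "card J = k - 1"
    using cT card le by (auto split: if_splits)
  have "i\<^sub>0 \<notin> J" using notin i0(2,3) by force
  hence "J \<subseteq> {..<n} - {i\<^sub>0}" by (auto simp: J_def)
  thus ?thesis using that[of i\<^sub>0 s\<^sub>0 J] i0 cardJ T' by blast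
qed

section \<open>The generating function of \<open>p\<^sup>B\<close>\<close>

lemma card_symmetric_interval: "real (card {- int m..int m}) = 2 * real m + 1"
  by (simp add: nat_add_distrib nat_mult_distrib)

lemma card_lattice_points_cube:
  "real (card ({..<n} \<rightarrow>\<^sub>E {- int m..int m})) = (2 * real m + 1) ^ n"
  by (simp only: card_PiE finite_lessThan prod_constant of_nat_power card_lessThan card_symmetric_interval)

text \<open>
  The coordinates are chosen independently: \<open>2 m\<close> values remain for the coordinate of the single
  facet, \<open>2 m - 1\<close> for each of the \<open>k - 1\<close> coordinates of the pairs, and \<open>2 m + 1\<close> for the others.  For
  \<open>m = 0\<close> the first factor vanishes, so it does no harm that \<open>2 m - 1\<close> is then not a
  cardinality.
\<close>

lemma card_lattice_points_off_facets:
  assumes i: "i\<^sub>0 < n" and s: "s\<^sub>0 = 1 \<or> s\<^sub>0 = -1"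
    and J: "J \<subseteq> {..<n} - {i\<^sub>0}" and k: "card J = k - 1" "1 \<le> k"
  shows "real (card {g \<in> {..<n} \<rightarrow>\<^sub>E {- int m..int m}. g i\<^sub>0 \<noteq> s\<^sub>0 * int m \<and> (\<forall>i\<in>J. \<bar>g i\<bar> \<noteq> int m)})
    = 2 * real m * (2 * real m - 1) ^ (k - 1) * (2 * real m + 1) ^ (n - k)"
proof -
  let ?I = "{- int m..int m}"
  define A where "A i = (if i = i\<^sub>0 then ?I - {s\<^sub>0 * int m} else if i \<in> J then ?I - {int m, - int m} else ?I)" for i
  define R where "R = {..<n} - {i\<^sub>0} - J"
  have finJ: "finite J" using J by (rule finite_subset) simp
  have "card ({..<n} - {i\<^sub>0} - J) = card ({..<n} - {i\<^sub>0}) - card J"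
    using J finJ by (intro card_Diff_subset)
  hence cR: "card R = n - k" using k i by (simp add: R_def)
  have partition: "{..<n} = insert i\<^sub>0 (J \<union> R)" using i J by (auto simp: R_def)
  have disj: "i\<^sub>0 \<notin> J \<union> R" "J \<inter> R = {}" "finite R" using J by (auto simp: R_def)
  \<comment> \<open>The condition is imposed coordinatewise, so the set is a product of finite sets.\<close>
  have "{g \<in> {..<n} \<rightarrow>\<^sub>E ?I. g i\<^sub>0 \<noteq> s\<^sub>0 * int m \<and> (\<forall>i\<in>J. \<bar>g i\<bar> \<noteq> int m)} = (\<Pi>\<^sub>E i\<in>{..<n}. A i)"
  proof (intro equalityI subsetI)
    fix g assume g: "g \<in> {g \<in> {..<n} \<rightarrow>\<^sub>E ?I. g i\<^sub>0 \<noteq> s\<^sub>0 * int m \<and> (\<forall>i\<in>J. \<bar>g i\<bar> \<noteq> int m)}"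
    show "g \<in> (\<Pi>\<^sub>E i\<in>{..<n}. A i)"
    proof (rule PiE_I)
      fix i assume "i \<in> {..<n}"
      hence "g i \<in> ?I" using g by (auto dest: PiE_mem)
      thus "g i \<in> A i" using g by (auto simp: A_def)
    qed (use g in \<open>auto dest: PiE_arb\<close>)
  next
    fix g assume g: "g \<in> (\<Pi>\<^sub>E i\<in>{..<n}. A i)"
    have "g \<in> {..<n} \<rightarrow>\<^sub>E ?I"
      using g by (rule subsetD[OF PiE_mono, rotated]) (auto simp: A_def)
    moreover have "g i\<^sub>0 \<noteq> s\<^sub>0 * int m" using PiE_mem[OF g, of i\<^sub>0] i by (auto simp: A_def)
    moreover have "\<bar>g j\<bar> \<noteq> int m" if "j \<in> J" for j
      using PiE_mem[OF g, of j] that J by (auto simp: A_def abs_if split: if_splits)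
    ultimately show "g \<in> {g \<in> {..<n} \<rightarrow>\<^sub>E ?I. g i\<^sub>0 \<noteq> s\<^sub>0 * int m \<and> (\<forall>i\<in>J. \<bar>g i\<bar> \<noteq> int m)}" by blast
  qed
  hence "real (card {g \<in> {..<n} \<rightarrow>\<^sub>E ?I. g i\<^sub>0 \<noteq> s\<^sub>0 * int m \<and> (\<forall>i\<in>J. \<bar>g i\<bar> \<noteq> int m)})
      = (\<Prod>i<n. real (card (A i)))" by (simp add: card_PiE)
  also have "(\<Prod>i<n. real (card (A i))) = real (card (A i\<^sub>0)) * ((\<Prod>i\<in>J. real (card (A i))) * (\<Prod>i\<in>R. real (card (A i))))"
    unfolding partition using finJ disj by (simp add: prod.union_disjoint)
  also have "real (card (A i\<^sub>0)) = 2 * real m"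
  proof -
    have "card (A i\<^sub>0) = card ?I - 1" using s by (auto simp: A_def card_Diff_singleton)
    thus ?thesis using card_symmetric_interval[of m] by simp
  qed
  also have "(\<Prod>i\<in>R. real (card (A i))) = (2 * real m + 1) ^ (n - k)"
  proof -
    have "(\<Prod>i\<in>R. real (card (A i))) = (\<Prod>i\<in>R. 2 * real m + 1)"
      by (intro prod.cong refl) (use card_symmetric_interval[of m] in \<open>auto simp: R_def A_def\<close>)
    thus ?thesis by (simp add: cR)
  qed
  also have "2 * real m * ((\<Prod>i\<in>J. real (card (A i))) * (2 * real m + 1) ^ (n - k))
      = 2 * real m * ((2 * real m - 1) ^ (k - 1) * (2 * real m + 1) ^ (n - k))"
  proof (cases "m = 0")
    case False
    have "card (?I - {int m, - int m}) = card ?I - card {int m, - int m}"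
      by (intro card_Diff_subset) auto
    hence "real (card (?I - {int m, - int m})) = 2 * real m - 1"
      using card_symmetric_interval[of m] False by (simp add: card_insert_if)
    hence "(\<Prod>i\<in>J. real (card (A i))) = (\<Prod>i\<in>J. 2 * real m - 1)"
      by (intro prod.cong refl) (use J in \<open>auto simp: A_def\<close>)
    thus ?thesis by (simp add: k)
  qed simp
  finally show ?thesis by (simp only: mult.assoc)
qed

lemma card_interior_lattice_points:
  assumes "1 \<le> m"
  shows "real (card {g \<in> {..<n} \<rightarrow>\<^sub>E {- int m..int m}. \<forall>i<n. \<bar>g i\<bar> \<noteq> int m}) = (2 * real m - 1) ^ n"
proof -
  have "{g \<in> {..<n} \<rightarrow>\<^sub>E {- int m..int m}. \<forall>i<n. \<bar>g i\<bar> \<noteq> int m} = {..<n} \<rightarrow>\<^sub>E {- int (m - 1)..int (m - 1)}"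
    (is "?L = ?R")
  proof (intro equalityI subsetI)
    fix g assume g: "g \<in> ?L"
    show "g \<in> ?R"
    proof (rule PiE_I)
      fix i assume i: "i \<in> {..<n}"
      hence "\<bar>g i\<bar> \<le> int m" "\<bar>g i\<bar> \<noteq> int m" using g by (auto intro: abs_le_of_box)
      thus "g i \<in> {- int (m - 1)..int (m - 1)}" using assms by (auto simp: of_nat_diff)
    qed (use g in \<open>auto dest: PiE_arb\<close>)
  next
    fix g assume g: "g \<in> ?R"
    have "g \<in> {..<n} \<rightarrow>\<^sub>E {- int m..int m}"
      using g by (rule subsetD[OF PiE_mono, rotated]) auto
    moreover have "\<bar>g i\<bar> \<noteq> int m" if "i < n" for i
      using abs_le_of_box[OF g that] assms by auto
    ultimately show "g \<in> ?L" by blast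
  qed
  thus ?thesis using assms by (simp only: card_lattice_points_cube) (simp add: of_nat_diff)
qed

text \<open>
  For \<open>m \<ge> 1\<close> this is the number of lattice points of \<open>[-m, m]\<^sup>n\<close> that avoid the removed dilated
  facets, doubled for \<open>1 \<le> k \<le> n\<close> like \<open>p\<^sup>B\<close> itself.
\<close>

definition pB_coeff :: "nat \<Rightarrow> nat \<Rightarrow> nat \<Rightarrow> real" where
  "pB_coeff n k m =
     (if k = 0 then (2 * real m + 1) ^ n
      else if k \<le> n then 4 * real m * (2 * real m - 1) ^ (k - 1) * (2 * real m + 1) ^ (n - k)
      else if 1 \<le> m then (2 * real m - 1) ^ n else 0)"

lemma fps_of_poly_pB:
  assumes sel: "1 \<le> k \<and> k \<le> n \<Longrightarrow> facet_selection n k (S n k)"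
  shows "fps_of_poly (pB S n k) = Abs_fps (pB_coeff n k) * (1 - fps_X) ^ (n + 1)"
proof -
  define c where "c m = real (card {g \<in> {..<n} \<rightarrow>\<^sub>E {- int m..int m}. set (flag n m g) \<notin> removed_faces S n k})" for m
  have h: "fps_of_poly (h_poly (bary_cube n) (removed_faces S n k)) = Abs_fps c * (1 - fps_X) ^ (n + 1)"
    unfolding c_def by (rule fps_of_poly_h_poly_bary_cube)
  consider "k = 0" | "1 \<le> k" "k \<le> n" | "n < k" by linarith
  thus ?thesis
  proof cases
    case 1
    have "c = pB_coeff n k"
      using card_lattice_points_cube[of n] by (simp add: 1 c_def removed_faces_def pB_coeff_def fun_eq_iff)
    thus ?thesis using h by (simp add: 1 pB_def)
  next
    case 2
    have "facet_selection n k (S n k)" "0 < n" using sel 2 by auto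
    then obtain i\<^sub>0 s\<^sub>0 J where i: "i\<^sub>0 < n" and s: "s\<^sub>0 = 1 \<or> s\<^sub>0 = -1" and J: "J \<subseteq> {..<n} - {i\<^sub>0}" "card J = k - 1"
      and S: "S n k = insert (std_facet n i\<^sub>0 s\<^sub>0) ((\<lambda>(i, s). std_facet n i s) ` (J \<times> {1, -1}))"
      by (rule facet_selectionE)
    define s' :: int where "s' = (if s\<^sub>0 = 1 then 1 else -1)"
    have s': "s\<^sub>0 = of_int s'" "s' = 1 \<or> s' = -1" using s by (auto simp: s'_def)
    have kept: "set (flag n m g) \<notin> removed_faces S n k \<longleftrightarrow> g i\<^sub>0 \<noteq> s' * int m \<and> (\<forall>i\<in>J. \<bar>g i\<bar> \<noteq> int m)"
      if g: "g \<in> {..<n} \<rightarrow>\<^sub>E {- int m..int m}" for g m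
    proof -
      have eq: "set (flag n m g) \<in> removed_faces S n k \<longleftrightarrow>
          \<Union> (set (flag n m g)) \<subseteq> std_facet n i\<^sub>0 (of_int s')
          \<or> (\<exists>i\<in>J. \<Union> (set (flag n m g)) \<subseteq> std_facet n i (of_int 1) \<or> \<Union> (set (flag n m g)) \<subseteq> std_facet n i (of_int (-1)))"
        using 2 by (simp add: removed_faces_def S s'(1) set_flag_in_faces_in_iff[OF g])
      have abs: "\<bar>x\<bar> = int m \<longleftrightarrow> x = 1 * int m \<or> x = (-1) * int m" for x
        by (auto simp: abs_if)
      have facet: "\<Union> (set (flag n m g)) \<subseteq> std_facet n i (of_int t) \<longleftrightarrow> g i = t * int m"
        if "i = i\<^sub>0 \<or> i \<in> J" "t = 1 \<or> t = -1" for i t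
        using that i J by (intro flag_in_facet_iff[OF g]) auto
      have "(\<exists>i\<in>J. \<Union> (set (flag n m g)) \<subseteq> std_facet n i (of_int 1) \<or> \<Union> (set (flag n m g)) \<subseteq> std_facet n i (of_int (-1)))
          \<longleftrightarrow> (\<exists>i\<in>J. g i = 1 * int m \<or> g i = (-1) * int m)"
      proof (rule bex_cong[OF refl])
        fix i assume i: "i \<in> J"
        show "(\<Union> (set (flag n m g)) \<subseteq> std_facet n i (of_int 1) \<or> \<Union> (set (flag n m g)) \<subseteq> std_facet n i (of_int (-1)))
          \<longleftrightarrow> (g i = 1 * int m \<or> g i = (-1) * int m)"
          by (subst (1 2) facet) (use i in auto)
      qed
      moreover have "\<Union> (set (flag n m g)) \<subseteq> std_facet n i\<^sub>0 (of_int s') \<longleftrightarrow> g i\<^sub>0 = s' * int m"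
        using s'(2) by (intro facet) auto
      moreover have "(\<exists>i\<in>J. g i = 1 * int m \<or> g i = (-1) * int m) \<longleftrightarrow> \<not> (\<forall>i\<in>J. \<bar>g i\<bar> \<noteq> int m)"
        unfolding abs by blast
      ultimately show ?thesis unfolding eq by (simp only: de_Morgan_disj not_not)
    qed
    have "c m = real (card {g \<in> {..<n} \<rightarrow>\<^sub>E {- int m..int m}. g i\<^sub>0 \<noteq> s' * int m \<and> (\<forall>i\<in>J. \<bar>g i\<bar> \<noteq> int m)})" for m
      unfolding c_def by (intro arg_cong[where f = "\<lambda>A. real (card A)"] Collect_cong conj_cong refl kept)
    hence "c m = 2 * real m * (2 * real m - 1) ^ (k - 1) * (2 * real m + 1) ^ (n - k)" for m
      using card_lattice_points_off_facets[OF i s'(2) J 2(1)] by simp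
    hence "2 * Abs_fps c = Abs_fps (pB_coeff n k)"
      using 2 by (intro fps_ext) (simp add: pB_coeff_def numeral_fps_const)
    thus ?thesis using h 2 by (simp add: pB_def fps_of_poly_mult flip: mult.assoc)
  next
    case 3
    have "c m = pB_coeff n k m" for m
    proof -
      have "c m = real (card {g \<in> {..<n} \<rightarrow>\<^sub>E {- int m..int m}. m \<noteq> 0 \<and> (\<forall>i<n. \<bar>g i\<bar> \<noteq> int m)})"
        unfolding c_def
        by (intro arg_cong[where f = "\<lambda>A. real (card A)"] Collect_cong conj_cong refl)
           (use 3 in \<open>simp add: removed_faces_def set_flag_in_faces_in_iff flag_in_boundary_iff\<close>)
      thus ?thesis using card_interior_lattice_points[of m n] 3 by (cases "m = 0") (auto simp: pB_coeff_def)
    qed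
    hence "c = pB_coeff n k" by (rule ext)
    thus ?thesis using h 3 by (simp add: pB_def)
  qed
qed

lemma poly_eq_of_series:
  fixes p q :: "real poly"
  assumes "fps_of_poly p = F * (1 - fps_X) ^ N" "fps_of_poly q = G * (1 - fps_X) ^ N" "F = G"
  shows "p = q"
  using assms by (simp flip: fps_of_poly_eq_iff)

text \<open>
  The sum telescopes, since \<open>4 m = 2 m ((2 m + 1) - (2 m - 1))\<close>.  The right-hand side is the
  coefficient of \<open>x\<^sup>m\<close> in \<open>(1 - x) \<Sum> (2 j + 1)\<^bsup>n+1\<^esup> x\<^sup>j\<close>.
\<close>

lemma sum_pB_coeff:
  "(\<Sum>k = 0..n + 1. pB_coeff n k m) =
     (2 * real m + 1) ^ (n + 1) - (if m = 0 then 0 else (2 * real (m - 1) + 1) ^ (n + 1))"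
proof -
  have tel: "(2 * real m + 1) ^ n + (\<Sum>k = 1..j. 4 * real m * (2 * real m - 1) ^ (k - 1) * (2 * real m + 1) ^ (n - k))
      = (2 * real m + 1) ^ (n + 1) - 2 * real m * (2 * real m - 1) ^ j * (2 * real m + 1) ^ (n - j)"
    if "j \<le> n" for j
    using that
  proof (induction j)
    case (Suc j)
    hence "n - j = Suc (n - Suc j)" by simp
    thus ?case using Suc by (simp add: algebra_simps)
  qed (simp add: algebra_simps)
  have "(\<Sum>k = 0..n + 1. pB_coeff n k m) = pB_coeff n 0 m + (\<Sum>k = 1..n. pB_coeff n k m) + pB_coeff n (n + 1) m"
    by (simp add: sum.atLeast_Suc_atMost)
  also have "(\<Sum>k = 1..n. pB_coeff n k m)
      = (\<Sum>k = 1..n. 4 * real m * (2 * real m - 1) ^ (k - 1) * (2 * real m + 1) ^ (n - k))"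
    by (intro sum.cong) (auto simp: pB_coeff_def)
  also have "pB_coeff n 0 m + \<dots> = (2 * real m + 1) ^ (n + 1) - 2 * real m * (2 * real m - 1) ^ n"
    using tel[of n] by (simp add: pB_coeff_def)
  also have "\<dots> + pB_coeff n (n + 1) m =
     (2 * real m + 1) ^ (n + 1) - (if m = 0 then 0 else (2 * real (m - 1) + 1) ^ (n + 1))"
  proof (cases m)
    case (Suc l)
    hence l: "2 * real (m - 1) + 1 = 2 * real m - 1" by simp
    have "pB_coeff n (n + 1) m = (2 * real m - 1) ^ n" using Suc by (simp add: pB_coeff_def)
    thus ?thesis unfolding l using Suc by (simp add: algebra_simps)
  qed (simp add: pB_coeff_def)
  finally show ?thesis .
qed

lemma one_minus_X_mult_nth:
  "fps_nth (F * (1 - fps_X)) m = fps_nth F m - (if m = 0 then 0 else fps_nth F (m - 1))"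
  for F :: "real fps"
  by (simp add: right_diff_distrib)

lemma pB_coeff_zero: "pB_coeff n 0 m = (2 * real m + 1) ^ n"
  and pB_coeff_middle: "1 \<le> k \<Longrightarrow> k \<le> n \<Longrightarrow>
    pB_coeff n k m = 4 * real m * (2 * real m - 1) ^ (k - 1) * (2 * real m + 1) ^ (n - k)"
  and pB_coeff_top: "pB_coeff n (Suc n) m = (if 1 \<le> m then (2 * real m - 1) ^ n else 0)"
  by (simp_all add: pB_coeff_def)

lemma two_mult_eq_smult: "2 * p = smult 2 p" for p :: "real poly"
  by (simp add: numeral_poly)

section \<open>Relations between the polynomials\<close>

text \<open>
  What follows uses the selection only through the generating functions, which are the same for
  every selection.
\<close>

locale selected_facets =
  fixes S :: "nat \<Rightarrow> nat \<Rightarrow> real vec set set"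
  assumes selection: "1 \<le> k \<Longrightarrow> k \<le> n \<Longrightarrow> facet_selection n k (S n k)"
begin

lemma pB_series: "fps_of_poly (pB S n k) = Abs_fps (pB_coeff n k) * (1 - fps_X) ^ (n + 1)"
  by (rule fps_of_poly_pB) (simp add: selection)

lemma pB_zero_eq_eulerian: "pB S n 0 = eulerian_B n"
proof -
  have "Abs_fps (pB_coeff n 0) = Abs_fps (\<lambda>m. (2 * real m + 1) ^ n)"
    by (rule fps_ext) (simp add: pB_coeff_zero)
  thus ?thesis by (rule poly_eq_of_series[OF pB_series fps_of_poly_eulerian_B])
qed

lemma pB_top_eq_eulerian: "pB S n (Suc n) = monom 1 1 * eulerian_B n"
proof (rule poly_eq_of_series[OF pB_series])
  show "fps_of_poly (monom 1 1 * eulerian_B n)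
      = (fps_X * Abs_fps (\<lambda>m. (2 * real m + 1) ^ n)) * (1 - fps_X) ^ (n + 1)"
    by (simp only: fps_of_poly_mult fps_of_poly_eulerian_B fps_of_poly_monom' power_one_right mult.assoc)
  show "Abs_fps (pB_coeff n (Suc n)) = fps_X * Abs_fps (\<lambda>m. (2 * real m + 1) ^ n)"
  proof (rule fps_ext)
    fix m show "fps_nth (Abs_fps (pB_coeff n (Suc n))) m = fps_nth (fps_X * Abs_fps (\<lambda>m. (2 * real m + 1) ^ n)) m"
      by (cases m) (simp_all add: pB_coeff_top add.commute)
  qed
qed

lemma sum_pB_eq_eulerian: "(\<Sum>k = 0..n + 1. pB S n k) = eulerian_B (Suc n)"
proof -
  let ?F = "\<Sum>k = 0..n + 1. Abs_fps (pB_coeff n k)"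
  let ?G = "Abs_fps (\<lambda>m. (2 * real m + 1) ^ (Suc n))"
  have "?F = ?G * (1 - fps_X)"
  proof (rule fps_ext)
    fix m
    have "fps_nth ?F m = (\<Sum>k = 0..n + 1. pB_coeff n k m)" by (simp only: fps_sum_nth fps_nth_Abs_fps)
    thus "fps_nth ?F m = fps_nth (?G * (1 - fps_X)) m"
      unfolding one_minus_X_mult_nth sum_pB_coeff by simp
  qed
  hence "?F * (1 - fps_X) ^ (n + 1) = ?G * (1 - fps_X) ^ (Suc n + 1)"
    by (simp add: mult.assoc)
  moreover have "fps_of_poly (\<Sum>k = 0..n + 1. pB S n k) = ?F * (1 - fps_X) ^ (n + 1)"
    by (simp only: fps_of_poly_sum pB_series sum_distrib_right)
  ultimately show ?thesis
    by (simp only: fps_of_poly_eulerian_B fps_of_poly_eq_iff[symmetric])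
qed

lemma pB_Suc_zero: "pB S (Suc n) 0 = (\<Sum>i = 0..n + 1. pB S n i)"
  by (simp only: pB_zero_eq_eulerian sum_pB_eq_eulerian)

lemma pB_Suc_top: "pB S (Suc n) (Suc (Suc n)) = monom 1 1 * (\<Sum>i = 0..n + 1. pB S n i)"
  by (simp only: pB_top_eq_eulerian sum_pB_eq_eulerian)

text \<open>
  Over the common denominator \<open>(1 - x)\<^bsup>n+2\<^esup>\<close> the polynomials for \<open>n\<close> appear multiplied by \<open>1 - x\<close>, so
  subtracting their coefficients amounts to adding \<open>x - 1\<close> times the polynomial.
\<close>

lemma pB_step:
  assumes "\<And>m. pB_coeff (Suc n) j m = a * pB_coeff (Suc n) k m - b * pB_coeff n l m"
  shows "pB S (Suc n) j = smult a (pB S (Suc n) k) + smult b (monom 1 1 - 1) * pB S n l"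
proof (rule poly_eq_of_series[OF pB_series])
  define y :: "real fps" where "y = 1 - fps_X"
  have X: "fps_X = 1 - y" by (simp add: y_def)
  show "fps_of_poly (smult a (pB S (Suc n) k) + smult b (monom 1 1 - 1) * pB S n l)
      = (fps_const a * Abs_fps (pB_coeff (Suc n) k) - fps_const b * Abs_fps (pB_coeff n l)) * (1 - fps_X) ^ (Suc n + 1)"
    unfolding fps_of_poly_add fps_of_poly_mult fps_of_poly_smult fps_of_poly_diff fps_of_poly_monom'
      fps_of_poly_1 pB_series y_def[symmetric] X power_one_right
    by (simp add: algebra_simps)
  show "Abs_fps (pB_coeff (Suc n) j) = fps_const a * Abs_fps (pB_coeff (Suc n) k) - fps_const b * Abs_fps (pB_coeff n l)"
    by (rule fps_ext) (simp add: assms)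
qed

lemma pB_step_bottom: "pB S (Suc n) 1 = 2 * pB S (Suc n) 0 + 2 * (monom 1 1 - 1) * pB S n 0"
proof -
  have "pB_coeff (Suc n) 1 m = 2 * pB_coeff (Suc n) 0 m - 2 * pB_coeff n 0 m" for m
    by (simp add: pB_coeff_zero pB_coeff_middle algebra_simps)
  thus ?thesis unfolding two_mult_eq_smult by (rule pB_step)
qed

lemma pB_step_middle:
  assumes "1 \<le> k" "k \<le> n"
  shows "pB S (Suc n) (Suc k) = pB S (Suc n) k + 2 * (monom 1 1 - 1) * pB S n k"
proof -
  have "pB_coeff (Suc n) (Suc k) m = 1 * pB_coeff (Suc n) k m - 2 * pB_coeff n k m" for m
  proof -
    obtain j where j: "k = Suc j" using assms by (cases k) auto
    have "Suc n - k = Suc (n - k)" using assms by simp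
    thus ?thesis using assms by (simp add: pB_coeff_middle) (simp add: j algebra_simps)
  qed
  thus ?thesis using pB_step[of n "Suc k" 1 k 2 k] by (simp only: two_mult_eq_smult smult_1_left)
qed

lemma pB_step_top:
  "pB S (Suc n) (Suc (Suc n)) = smult (1 / 2) (pB S (Suc n) (Suc n)) + (monom 1 1 - 1) * pB S n (Suc n)"
proof -
  have "pB_coeff (Suc n) (Suc (Suc n)) m = 1 / 2 * pB_coeff (Suc n) (Suc n) m - 1 * pB_coeff n (Suc n) m" for m
    unfolding pB_coeff_top by (cases m) (simp_all add: pB_coeff_middle algebra_simps)
  thus ?thesis using pB_step[of n "Suc (Suc n)" "1 / 2" "Suc n" 1 "Suc n"] by simp
qed

text \<open>
  Induction on \<open>k\<close>: by \<open>pB_step_middle\<close>, passing from \<open>k\<close> to \<open>k + 1\<close> adds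
  \<open>2 (x - 1) p\<^bsub>n,k\<^esub>\<close>, which moves the summand with index \<open>k\<close> from the second sum to the first.
\<close>

lemma pB_Suc_middle:
  assumes "1 \<le> k" "k \<le> n + 1"
  shows "pB S (Suc n) k = 2 * monom 1 1 * (\<Sum>i = 0..k - 1. pB S n i) + 2 * (\<Sum>i = k..n + 1. pB S n i)"
  using assms
proof (induction k rule: nat_induct_at_least)
  case base
  have "(\<Sum>i = 0..n + 1. pB S n i) = pB S n 0 + (\<Sum>i = 1..n + 1. pB S n i)"
    by (simp add: sum.atLeast_Suc_atMost)
  thus ?case unfolding pB_step_bottom pB_Suc_zero by (simp add: algebra_simps)
next
  case (Suc k)
  have "(\<Sum>i = k..n + 1. pB S n i) = pB S n k + (\<Sum>i = Suc k..n + 1. pB S n i)"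
    using Suc by (intro sum.atLeast_Suc_atMost) auto
  moreover have "(\<Sum>i = 0..k. pB S n i) = (\<Sum>i = 0..k - 1. pB S n i) + pB S n k"
    using Suc by (cases k) auto
  ultimately show ?case
    using Suc by (simp add: pB_step_middle algebra_simps)
qed

lemma pB_Suc_middle_smult:
  assumes "1 \<le> k" "k \<le> n + 1"
  shows "pB S (Suc n) k =
    smult 2 (monom 1 1 * (\<Sum>i = 0..k - 1. pB S n i)) + smult 2 (\<Sum>i = k..n + 1. pB S n i)"
  by (simp only: pB_Suc_middle[OF assms] two_mult_eq_smult mult_smult_left)

lemma pB_base: "pB S 0 0 = 1" "pB S 0 1 = monom 1 1"
  using pB_zero_eq_eulerian[of 0] pB_top_eq_eulerian[of 0] by (simp_all add: eulerian_B_0)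

lemma pB_Suc_cases:
  assumes "k \<le> n + 2"
  obtains "k = 0" | "1 \<le> k" "k \<le> n + 1" | "k = Suc (Suc n)"
  using assms by linarith

text \<open>
  The recurrences expressing the polynomials for \<open>n + 1\<close> through those for \<open>n\<close> have
  nonnegative coefficients.
\<close>

lemma coeff_pB_nonneg: "k \<le> n + 1 \<Longrightarrow> 0 \<le> coeff (pB S n k) i"
proof (induction n arbitrary: k i)
  case 0
  hence "k = 0 \<or> k = 1" by linarith
  thus ?case by (auto simp: pB_base[simplified])
next
  case (Suc n)
  have sum: "0 \<le> coeff (\<Sum>j\<in>A. pB S n j) i" if "A \<subseteq> {0..n + 1}" for A i
    unfolding coeff_sum using that Suc.IH by (intro sum_nonneg) auto
  have x: "0 \<le> coeff (monom 1 1 * p) i" if "\<And>i. 0 \<le> coeff p i" for p :: "real poly" and i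
    using that by (simp add: coeff_monom_mult)
  from Suc.prems have "k \<le> n + 2" by simp
  thus ?case
  proof (cases rule: pB_Suc_cases)
    case 1 thus ?thesis using sum[of "{0..n + 1}" i] by (simp only: pB_Suc_zero)
  next
    case 2
    have "0 \<le> coeff (monom 1 1 * (\<Sum>j = 0..k - 1. pB S n j)) i" using 2 by (intro x sum) auto
    moreover have "0 \<le> coeff (\<Sum>j = k..n + 1. pB S n j) i" by (intro sum) auto
    ultimately show ?thesis
      unfolding pB_Suc_middle_smult[OF 2] by simp
  next
    case 3 thus ?thesis unfolding 3 pB_Suc_top by (intro x sum) auto
  qed
qed

text \<open>
  As all coefficients are nonnegative, no leading terms cancel in the recurrences.  The
  polynomial with index \<open>n + 1\<close>, of degree \<open>n + 1\<close>, occurs without a factor \<open>x\<close> except in the last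
  recurrence, and the others have degree \<open>n\<close>.
\<close>

lemma degree_pB: "k \<le> n + 1 \<Longrightarrow> degree (pB S n k) = (if k = n + 1 then n + 1 else n)"
proof (induction n arbitrary: k)
  case 0
  hence "k = 0 \<or> k = 1" by linarith
  thus ?case by (auto simp: pB_base[simplified] degree_monom_eq)
next
  case (Suc n)
  have deg_le: "degree (\<Sum>j\<in>A. pB S n j) \<le> n + 1" if "A \<subseteq> {0..n + 1}" for A
    using that Suc.IH finite_subset[OF that] by (intro degree_sum_le) auto
  have deg: "degree (pB S n (n + 1)) = n + 1" using Suc.IH[of "n + 1"] by simp
  hence "pB S n (n + 1) \<noteq> 0" by auto
  hence "coeff (pB S n (n + 1)) (n + 1) \<noteq> 0" using leading_coeff_neq_0 deg by metis
  hence top: "0 < coeff (pB S n (n + 1)) (n + 1)"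
    using coeff_pB_nonneg[of "n + 1" n "n + 1"] by simp
  have top_sum: "0 < coeff (\<Sum>j\<in>A. pB S n j) (n + 1)" if "A \<subseteq> {0..n + 1}" "n + 1 \<in> A" for A
    unfolding coeff_sum using that top finite_subset[OF that(1)] coeff_pB_nonneg[of _ n "n + 1"]
    by (intro sum_pos2[of A "n + 1"]) auto
  have total: "degree (\<Sum>j = 0..n + 1. pB S n j) = n + 1"
    using deg_le[of "{0..n + 1}"] top_sum[of "{0..n + 1}"] by (intro antisym le_degree) auto
  from Suc.prems have "k \<le> n + 2" by simp
  thus ?case
  proof (cases rule: pB_Suc_cases)
    case 1 thus ?thesis using total by (simp add: pB_Suc_zero del: sum.atLeast0_atMost_Suc)
  next
    case 2
    have low: "degree (\<Sum>j = 0..k - 1. pB S n j) \<le> n"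
      using 2 Suc.IH by (intro degree_sum_le) auto
    have "coeff (monom 1 1 * (\<Sum>j = 0..k - 1. pB S n j)) (n + 1) \<ge> 0"
      using 2 by (auto simp: coeff_monom_mult coeff_sum intro!: sum_nonneg coeff_pB_nonneg)
    hence "coeff (pB S (Suc n) k) (n + 1) > 0"
      unfolding pB_Suc_middle_smult[OF 2]
      using top_sum[of "{k..n + 1}"] 2 by (simp add: add_nonneg_pos)
    moreover have "degree (pB S (Suc n) k) \<le> n + 1"
    proof -
      have "degree (monom 1 1 * (\<Sum>j = 0..k - 1. pB S n j)) \<le> n + 1"
        using degree_mult_le[of "monom 1 1" "\<Sum>j = 0..k - 1. pB S n j"] degree_monom_le[of "1::real" 1] low
        by linarith
      thus ?thesis
        unfolding pB_Suc_middle_smult[OF 2]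
        using deg_le[of "{k..n + 1}"] by (intro degree_add_le) auto
    qed
    ultimately have "degree (pB S (Suc n) k) = n + 1" by (intro antisym le_degree) auto
    thus ?thesis using 2 by simp
  next
    case 3
    have "(\<Sum>j = 0..n + 1. pB S n j) \<noteq> 0" using total by auto
    hence "degree (monom 1 1 * (\<Sum>j = 0..n + 1. pB S n j)) = n + 2"
      using total by (subst degree_mult_eq) (auto simp: degree_monom_eq)
    thus ?thesis unfolding 3 pB_Suc_top by simp
  qed
qed

text \<open>
  The reflection \<open>p \<mapsto> x\<^bsup>n+2\<^esup> p(1/x)\<close> exchanges the recurrences for \<open>k\<close> and \<open>n + 2 - k\<close>: it
  reverses the summands by the induction hypothesis, and it moves the factor \<open>x\<close> from one sum to the
  other.
\<close>

lemma poly_pB_reflect: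
  assumes "k \<le> n + 1" "t \<noteq> 0"
  shows "poly (pB S n (n + 1 - k)) t = t ^ (n + 1) * poly (pB S n k) (1 / t)"
  using assms(1)
proof (induction n arbitrary: k)
  case 0
  hence "k = 0 \<or> k = 1" by linarith
  thus ?case using assms(2) by (auto simp: pB_base[simplified] poly_monom)
next
  case (Suc n)
  have reflect: "t ^ (n + 1) * poly (\<Sum>i\<in>A. pB S n i) (1 / t) = poly (\<Sum>i\<in>(\<lambda>i. n + 1 - i) ` A. pB S n i) t"
    if "A \<subseteq> {0..n + 1}" for A
  proof -
    have "inj_on (\<lambda>i. n + 1 - i) A" using that by (intro inj_onI) (auto simp: subset_iff, metis diff_diff_cancel)
    thus ?thesis
      using that Suc.IH by (auto simp: poly_sum sum.reindex sum_distrib_left subset_iff intro!: sum.cong)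
  qed
  have img: "(\<lambda>i. n + 1 - i) ` {a..b} = {n + 1 - b..n + 1 - a}" if "a \<le> n + 1" "b \<le> n + 1" for a b
  proof (intro equalityI subsetI)
    fix i assume "i \<in> {n + 1 - b..n + 1 - a}"
    thus "i \<in> (\<lambda>i. n + 1 - i) ` {a..b}" using that by (intro image_eqI[of _ _ "n + 1 - i"]) auto
  qed (use that in auto)
  have total: "t ^ (n + 1) * poly (\<Sum>i = 0..n + 1. pB S n i) (1 / t) = poly (\<Sum>i = 0..n + 1. pB S n i) t"
    using reflect[of "{0..n + 1}"] img[of 0 "n + 1"] by simp
  have px: "poly (monom 1 1 * p) u = u * poly p u" for p :: "real poly" and u
    by (simp add: poly_monom)
  from Suc.prems have "k \<le> n + 2" by simp
  thus ?case
  proof (cases rule: pB_Suc_cases)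
    case 1
    have "poly (pB S (Suc n) (Suc (Suc n))) t = t * (t ^ (n + 1) * poly (pB S (Suc n) 0) (1 / t))"
      unfolding pB_Suc_zero pB_Suc_top px total ..
    thus ?thesis by (simp add: 1)
  next
    case 2
    \<comment> \<open>The recurrence at \<open>k\<close> is reflected to the one at \<open>k\'\<close>; \<open>A\<close> and \<open>B\<close> are the two sums in the latter.\<close>
    define k' where "k' = n + 2 - k"
    have k': "1 \<le> k'" "k' \<le> n + 1" "k' - 1 = n + 1 - k" "k' = n + 1 - (k - 1)" using 2 by (auto simp: k'_def)
    define A where "A = (\<Sum>i = 0..k' - 1. pB S n i)"
    define B where "B = (\<Sum>i = k'..n + 1. pB S n i)"
    have A: "t ^ (n + 1) * poly (\<Sum>i = k..n + 1. pB S n i) (1 / t) = poly A t"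
      using reflect[of "{k..n + 1}"] img[of k "n + 1"] 2 by (simp add: A_def k'(3)[simplified])
    have B: "t ^ (n + 1) * poly (\<Sum>i = 0..k - 1. pB S n i) (1 / t) = poly B t"
      using reflect[of "{0..k - 1}"] img[of 0 "k - 1"] 2 by (simp add: B_def k'(4))
    have "t ^ (Suc n + 1) * poly (pB S (Suc n) k) (1 / t)
        = 2 * (t * (1 / t)) * (t ^ (n + 1) * poly (\<Sum>i = 0..k - 1. pB S n i) (1 / t))
          + 2 * t * (t ^ (n + 1) * poly (\<Sum>i = k..n + 1. pB S n i) (1 / t))"
      unfolding pB_Suc_middle_smult[OF 2] poly_add poly_smult px
      by (simp only: power_add power_one_right power_Suc algebra_simps)
    also have "\<dots> = 2 * poly B t + 2 * t * poly A t"
      unfolding A B using assms(2) by simp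
    also have "\<dots> = poly (pB S (Suc n) k') t"
      unfolding pB_Suc_middle_smult[OF k'(1,2)] poly_add poly_smult px A_def B_def
      by simp
    finally show ?thesis by (simp add: k'_def)
  next
    case 3
    have "poly (pB S (Suc n) 0) t = (t * (1 / t)) * (t ^ (n + 1) * poly (\<Sum>i = 0..n + 1. pB S n i) (1 / t))"
      unfolding pB_Suc_zero total using assms(2) by simp
    also have "\<dots> = t ^ (Suc n + 1) * poly (pB S (Suc n) (Suc (Suc n))) (1 / t)"
      unfolding pB_Suc_top px by (simp only: power_add power_one_right power_Suc mult_ac)
    finally show ?thesis by (simp add: 3)
  qed
qed

end

theorem proposition3p3:
  fixes n :: nat and S :: "nat \<Rightarrow> nat \<Rightarrow> real vec set set"
  assumes "\<forall>m k. 1 \<le> k \<and> k \<le> m \<longrightarrow> facet_selection m k (S m k)"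
  shows
    "let x = (monom 1 1 :: real poly) in
    \<comment> \<open>(a)\<close>
     (\<forall>k \<le> n + 1. (\<forall>i. 0 \<le> coeff (pB S n k) i) \<and>
        degree (pB S n k) = (if k = n + 1 then n + 1 else n)) \<and>
    \<comment> \<open>(b)\<close>
     (\<forall>k \<le> n + 1. \<forall>t :: real. t \<noteq> 0 \<longrightarrow>
        poly (pB S n (n + 1 - k)) t = t ^ (n + 1) * poly (pB S n k) (1 / t)) \<and>
    \<comment> \<open>(c)\<close>
     pB S n 0 = eulerian_B n \<and>
     pB S n (n + 1) = x * eulerian_B n \<and>
     (\<Sum>k = 0..n + 1. pB S n k) = eulerian_B (n + 1) \<and>
    \<comment> \<open>(d)\<close>
     (\<forall>k \<le> n + 1. pB S (n + 1) (k + 1) =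
        (if k = 0 then 2 * pB S (n + 1) 0 + 2 * (x - 1) * pB S n 0
         else if k \<le> n then pB S (n + 1) k + 2 * (x - 1) * pB S n k
         else smult (1 / 2) (pB S (n + 1) (n + 1)) + (x - 1) * pB S n (n + 1))) \<and>
    \<comment> \<open>(e)\<close>
     (\<forall>k \<le> n + 2. pB S (n + 1) k =
        (if k = 0 then (\<Sum>i = 0..n + 1. pB S n i)
         else if k \<le> n + 1 then
           2 * x * (\<Sum>i = 0..k - 1. pB S n i) + 2 * (\<Sum>i = k..n + 1. pB S n i)
         else x * (\<Sum>i = 0..n + 1. pB S n i))) \<and>
    \<comment> \<open>(f)\<close>
     (\<forall>k \<le> n + 1. fps_of_poly (pB S n k) / (1 - fps_X) ^ (n + 1) =
        Abs_fps (\<lambda>m.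
          if k = 0 then (2 * real m + 1) ^ n
          else if k \<le> n then 4 * real m * (2 * real m - 1) ^ (k - 1) * (2 * real m + 1) ^ (n - k)
          else if 1 \<le> m then (2 * real m - 1) ^ n else 0))"
proof -
  interpret selected_facets S using assms by unfold_locales blast
  have series: "fps_of_poly (pB S n k) / (1 - fps_X) ^ (n + 1) = Abs_fps (pB_coeff n k)" for k
  proof -
    have "((1 - fps_X) ^ (n + 1) :: real fps) \<noteq> 0" by (intro power_not_zero) (metis fps_X_neq_one right_minus_eq)
    thus ?thesis unfolding pB_series by (rule nonzero_mult_div_cancel_right)
  qed
  have d: "pB S (n + 1) (k + 1) =
        (if k = 0 then 2 * pB S (n + 1) 0 + 2 * (monom 1 1 - 1) * pB S n 0
         else if k \<le> n then pB S (n + 1) k + 2 * (monom 1 1 - 1) * pB S n k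
         else smult (1 / 2) (pB S (n + 1) (n + 1)) + (monom 1 1 - 1) * pB S n (n + 1))"
    if "k \<le> n + 1" for k
    using that pB_step_bottom[of n] pB_step_middle[of k n] pB_step_top[of n]
    by (cases "k = n + 1") auto
  have e: "pB S (n + 1) k =
        (if k = 0 then (\<Sum>i = 0..n + 1. pB S n i)
         else if k \<le> n + 1 then
           2 * monom 1 1 * (\<Sum>i = 0..k - 1. pB S n i) + 2 * (\<Sum>i = k..n + 1. pB S n i)
         else monom 1 1 * (\<Sum>i = 0..n + 1. pB S n i))"
    if "k \<le> n + 2" for k
    using that
  proof (cases rule: pB_Suc_cases)
    case 1 thus ?thesis using pB_Suc_zero[of n] by simp
  next
    case 2
    thus ?thesis using pB_Suc_middle[OF 2] by simp
  next
    case 3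
    thus ?thesis using pB_Suc_top[of n] by simp
  qed
  show ?thesis
    unfolding Let_def
  proof (intro conjI allI impI)
    show "pB S n 0 = eulerian_B n" by (rule pB_zero_eq_eulerian)
    show "pB S n (n + 1) = monom 1 1 * eulerian_B n" using pB_top_eq_eulerian by simp
    show "(\<Sum>k = 0..n + 1. pB S n k) = eulerian_B (n + 1)"
      using sum_pB_eq_eulerian by (simp only: Suc_eq_plus1)
  qed (fact coeff_pB_nonneg degree_pB poly_pB_reflect d e | rule series[unfolded pB_coeff_def[abs_def]])+
qed

end
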